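(* Let $f(\zeta,t)$ be a locally univalent solution of the Polubarinova-Galin equation with $q(t)>0$ and with $g=f'$ rational, $$g(\zeta,t)=b(t)\frac{\prod_{k=1}^{m}(\zeta-\omega_k(t))}{\prod_{j=1}^{n}(\zeta-\zeta_j(t))},\qquad m\ge n.$$ Then $$\frac{d}{dt}\sum_{k=1}^m\log\omega_k(t)-\frac{d}{dt}\sum_{j=1}^n\log\zeta_j(t)=\begin{cases}2\left(\int d\mu-A_\infty\right)&\text{if } m=n,\\ (m-n+2)\int d\mu&\text{if } m>n.\end{cases}$$ In particular, if $m>n$, $$\frac{d}{dt}\sum_{k=1}^m\log|\omega_k(t)|>\frac{d}{dt}\sum_{j=1}^n\log|\zeta_j(t)|,\qquad \frac{d}{dt}\sum_{k=1}^m\arg\omega_k(t)=\frac{d}{dt}\sum_{j=1}^n\arg\zeta_j(t).$$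
   Context: Notation: $\mathbb{D}$ is the open unit disk; dot denotes $\partial/\partial t$, prime denotes $\partial/\partial\zeta$. Locally univalent solution: for $t$ in a time interval, $f(\cdot,t)$ is analytic in a neighborhood of $\overline{\mathbb{D}}$, $f(0,t)=0$, $f'(0,t)>0$, $f'(\zeta,t)\neq0$ for $\zeta\in\overline{\mathbb{D}}$, $f$ depends smoothly on $t$, and $\operatorname{Re}[\dot f(\zeta,t)\overline{\zeta f'(\zeta,t)}]=q(t)$ for $\zeta\in\partial\mathbb{D}$, where $q$ is a given continuous function. Form of $g=f'$: $b(t)\neq0$, $|\omega_k|>1$, $|\zeta_j|>1$, no zero coincides with a pole; zeros and poles are repeated according to multiplicity; $m,n$ are fixed on the time interval considered. The sums of logarithms and arguments are taken with branches continuous in $t$. $\int d\mu=\dfrac{1}{2\pi}\displaystyle\int_0^{2\pi}\frac{q(t)}{|f'(e^{i\theta},t)|^2}\,d\theta$, and, when $m=n$, $A_\infty=\lim_{\zeta\to\infty}\dfrac{q(t)}{g(\zeta,t)\overline{g(1/\bar\zeta,t)}}=\dfrac{q(t)}{b(t)a_1(t)}$ with $a_1(t)=f'(0,t)>0$. *)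

theory Defs
  imports "HOL-Complex_Analysis.Complex_Analysis"
begin

definition time_interval :: "real set \<Rightarrow> bool" where
  "time_interval T \<longleftrightarrow> is_interval T \<and> interior T \<noteq> {}"

text \<open>
  Derivatives in \<open>t\<close> are taken within the time interval, so they are one-sided at an end point
  that belongs to it. Derivatives in \<open>\<zeta>\<close> are complex derivatives at fixed time.
\<close>

definition space_deriv :: "(complex \<Rightarrow> real \<Rightarrow> complex) \<Rightarrow> complex \<Rightarrow> real \<Rightarrow> complex" where
  "space_deriv f z t = deriv (\<lambda>w. f w t) z"

definition time_deriv :: "real set \<Rightarrow> (real \<Rightarrow> 'a::real_normed_vector) \<Rightarrow> real \<Rightarrow> 'a" where
  "time_deriv T u t = vector_derivative u (at t within T)"

text \<open>
  Smooth dependence on \<open>t\<close> is read as \<open>C\<^sup>1\<close> dependence; more smoothness in \<open>t\<close> would force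
  \<open>q\<close> to be more than continuous. The time derivative is only required to exist and be jointly
  continuous over the closed disk, where the equation refers to it.
\<close>

definition smooth_in_time :: "real set \<Rightarrow> (complex \<Rightarrow> real \<Rightarrow> complex) \<Rightarrow> bool" where
  "smooth_in_time T f \<longleftrightarrow>
     (\<forall>z\<in>cball 0 1. (\<lambda>t. f z t) differentiable_on T) \<and>
     continuous_on (cball 0 1 \<times> T) (\<lambda>(z, t). time_deriv T (f z) t)"

definition locally_univalent_solution ::
    "real set \<Rightarrow> (real \<Rightarrow> real) \<Rightarrow> (complex \<Rightarrow> real \<Rightarrow> complex) \<Rightarrow> bool" where
  "locally_univalent_solution T q f \<longleftrightarrow>
     (\<forall>t\<in>T. (\<lambda>z. f z t) analytic_on cball 0 1 \<and>
            f 0 t = 0 \<and>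
            space_deriv f 0 t \<in> \<real> \<and> Re (space_deriv f 0 t) > 0 \<and>
            (\<forall>z\<in>cball 0 1. space_deriv f z t \<noteq> 0)) \<and>
     smooth_in_time T f \<and>
     (\<forall>t\<in>T. \<forall>z\<in>sphere 0 1.
        Re (time_deriv T (f z) t * cnj (z * space_deriv f z t)) = q t)"

definition rational_fun ::
    "complex \<Rightarrow> nat \<Rightarrow> (nat \<Rightarrow> complex) \<Rightarrow> nat \<Rightarrow> (nat \<Rightarrow> complex) \<Rightarrow> complex \<Rightarrow> complex" where
  "rational_fun b m \<omega> n p z = b * (\<Prod>k<m. z - \<omega> k) / (\<Prod>j<n. z - p j)"

text \<open>
  The formula for \<open>f'\<close> is imposed on the closed disk only: the values of \<open>f\<close> further out are
  irrelevant, and the rational function itself provides the continuation of \<open>f'\<close>. The labelling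
  of the zeros and poles need not depend continuously on \<open>t\<close>.
\<close>

definition has_rational_derivative ::
    "real set \<Rightarrow> (complex \<Rightarrow> real \<Rightarrow> complex) \<Rightarrow> (real \<Rightarrow> complex) \<Rightarrow>
     nat \<Rightarrow> (nat \<Rightarrow> real \<Rightarrow> complex) \<Rightarrow> nat \<Rightarrow> (nat \<Rightarrow> real \<Rightarrow> complex) \<Rightarrow> bool" where
  "has_rational_derivative T f b m \<omega> n p \<longleftrightarrow>
     (\<forall>t\<in>T. b t \<noteq> 0 \<and>
            (\<forall>k<m. norm (\<omega> k t) > 1) \<and>
            (\<forall>j<n. norm (p j t) > 1) \<and>
            (\<forall>k<m. \<forall>j<n. \<omega> k t \<noteq> p j t) \<and>
            (\<forall>z\<in>cball 0 1.
               space_deriv f z t = rational_fun (b t) m (\<lambda>k. \<omega> k t) n (\<lambda>j. p j t) z))"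

definition mu_mass :: "real \<Rightarrow> (complex \<Rightarrow> real \<Rightarrow> complex) \<Rightarrow> real \<Rightarrow> real" where
  "mu_mass qt f t =
     1 / (2 * pi) * integral {0..2 * pi} (\<lambda>\<theta>. qt / (norm (space_deriv f (cis \<theta>) t))\<^sup>2)"

definition A_infinity :: "real \<Rightarrow> (complex \<Rightarrow> complex) \<Rightarrow> complex" where
  "A_infinity qt g = Lim at_infinity (\<lambda>z. of_real qt / (g z * cnj (g (1 / cnj z))))"

text \<open>
  A branch of \<open>\<Sum>k<N. log (z\<^sub>k t)\<close> (respectively \<open>\<Sum>k<N. arg (z\<^sub>k t)\<close>) that is continuous in \<open>t\<close>:
  at each time its value is the sum of some choice of logarithms (arguments) of the \<open>z\<^sub>k t\<close>. Only
  the sum has to be continuous, since the labelling of the \<open>z\<^sub>k\<close> may jump.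
\<close>

definition continuous_log_sum ::
    "real set \<Rightarrow> nat \<Rightarrow> (nat \<Rightarrow> real \<Rightarrow> complex) \<Rightarrow> (real \<Rightarrow> complex) \<Rightarrow> bool" where
  "continuous_log_sum T N z L \<longleftrightarrow>
     continuous_on T L \<and>
     (\<forall>t\<in>T. \<exists>l. (\<forall>k<N. exp (l k) = z k t) \<and> L t = (\<Sum>k<N. l k))"

definition continuous_arg_sum ::
    "real set \<Rightarrow> nat \<Rightarrow> (nat \<Rightarrow> real \<Rightarrow> complex) \<Rightarrow> (real \<Rightarrow> real) \<Rightarrow> bool" where
  "continuous_arg_sum T N z \<Theta> \<longleftrightarrow>
     continuous_on T \<Theta> \<and>
     (\<forall>t\<in>T. \<exists>\<theta>. (\<forall>k<N. z k t = of_real (norm (z k t)) * cis (\<theta> k)) \<and> \<Theta> t = (\<Sum>k<N. \<theta> k))"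

text \<open>For \<open>m = n\<close> the limit defining \<open>A_infinity\<close> exists and equals \<open>q / (b a\<^sub>1)\<close>.\<close>

lemma A_infinity_limit:
  assumes b: "b \<noteq> 0" and \<omega>: "\<And>k. k < n \<Longrightarrow> \<omega> k \<noteq> 0" and p: "\<And>j. j < n \<Longrightarrow> p j \<noteq> 0"
  defines "g \<equiv> rational_fun b n \<omega> n p"
  shows "((\<lambda>z. of_real q / (g z * cnj (g (1 / cnj z)))) \<longlongrightarrow> of_real q / (b * cnj (g 0))) at_infinity"
    and "A_infinity q g = of_real q / (b * cnj (g 0))"
proof -
  have q1: "((\<lambda>z. (z - \<omega> k) / (z - p k)) \<longlongrightarrow> 1) at_infinity" for k
  proof -
    have "((\<lambda>z. (1 - \<omega> k * inverse z) / (1 - p k * inverse z)) \<longlongrightarrow> (1 - \<omega> k * 0) / (1 - p k * 0)) at_infinity"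
      by (intro tendsto_intros tendsto_inverse_0) auto
    moreover have "eventually (\<lambda>z. (1 - \<omega> k * inverse z) / (1 - p k * inverse z) = (z - \<omega> k) / (z - p k)) at_infinity"
      using eventually_not_equal_at_infinity[of "0::complex"]
      by eventually_elim (auto simp: divide_simps)
    ultimately show ?thesis by (simp add: tendsto_cong)
  qed
  have g_eq: "g = (\<lambda>z. b * (\<Prod>k<n. (z - \<omega> k) / (z - p k)))"
    by (auto simp: g_def rational_fun_def prod_dividef)
  have "(g \<longlongrightarrow> b * (\<Prod>k<n. 1)) at_infinity"
    unfolding g_eq by (intro tendsto_intros q1)
  hence 1: "(g \<longlongrightarrow> b) at_infinity" by simp
  have "((\<lambda>z. cnj (inverse z)) \<longlongrightarrow> cnj 0) at_infinity"
    by (intro tendsto_cnj tendsto_inverse_0)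
  hence i: "((\<lambda>z::complex. 1 / cnj z) \<longlongrightarrow> 0) at_infinity" by (simp add: divide_inverse)
  have "isCont g 0" unfolding g_eq using p by (intro continuous_intros) auto
  hence 2: "((\<lambda>z. g (1 / cnj z)) \<longlongrightarrow> g 0) at_infinity"
    using i isCont_tendsto_compose by blast
  have "g 0 \<noteq> 0" unfolding g_eq using b \<omega> p by auto
  thus L: "((\<lambda>z. of_real q / (g z * cnj (g (1 / cnj z)))) \<longlongrightarrow> of_real q / (b * cnj (g 0))) at_infinity"
    using b by (intro tendsto_intros 1 2) auto
  show "A_infinity q g = of_real q / (b * cnj (g 0))"
    unfolding A_infinity_def by (intro tendsto_Lim L) (rule trivial_limit_at_infinity)
qed

end

theory Submission
  imports Defs "HOL-Computational_Algebra.Field_as_Ring" "HOL-Computational_Algebra.Polynomial_Factorial"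
    "HOL-Computational_Algebra.Fundamental_Theorem_Algebra"
begin

text \<open>
  Write \<open>f' = P / Q\<close> with \<open>Q 0 = 1\<close>. The Polubarinova-Galin equation says that
  \<open>f\<^sub>t / (\<zeta> f')\<close> has real part \<open>q |Q / P|\<^sup>2\<close> on the circle. Splitting this rational function
  into its parts with poles outside and inside the circle shows that \<open>f\<^sub>t / (\<zeta> f') = C / P\<close> for
  a polynomial \<open>C\<close> with \<open>degree C \<le> m\<close>; its value at \<open>0\<close> is the mean \<open>\<integral> d\<mu>\<close> and its
  value at \<open>\<infinity>\<close> is \<open>2 A\<^sub>\<infinity> - \<integral> d\<mu>\<close>, where \<open>A\<^sub>\<infinity>\<close> is read as \<open>0\<close> if \<open>m > n\<close>.
  Comparing the lowest and the highest coefficients in \<open>\<partial>\<^sub>t (P / Q) = (\<zeta> C / Q)'\<close> gives the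
  logarithmic derivatives of \<open>f' 0\<close> and of \<open>b\<close>, and
  \<open>f' 0 = \<plusminus> b \<Prod>\<omega>\<^sub>k / \<Prod>\<zeta>\<^sub>j\<close>.
\<close>

section \<open>Rational functions with prescribed real part on the circle\<close>

text \<open>The labelling of the zeros and poles may jump and roots may collide, so no single
  \<open>\<omega> k\<close> or \<open>\<zeta> j\<close> need be differentiable in time. Coefficients
  are symmetric in the roots, and the extreme ones carry the two products. The normalisation of
  \<open>Q\<close> at 0 removes the common scalar factor of \<open>P\<close> and \<open>Q\<close>
  and, as all poles lie outside the disk, bounds the coefficients of \<open>Q\<close>. Their
  differentiability has to be derived: it comes from the Taylor coefficients of \<open>f\<close> at
  0 and the coprimality of \<open>P t\<close> and \<open>Q t\<close>.

  The other obstacle is that the time derivative of \<open>f\<close> is only continuous up to the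
  circle and not given as a rational function. A fraction \<open>C / P\<close> with the right real
  part is constructed instead; the maximum principle leaves an imaginary constant, which goes into
  \<open>C\<close> and is fixed by \<open>f' 0\<close> being real. The value at infinity comes from
  reflection in the circle: \<open>h = C / P\<close> satisfies
  \<open>h(\<infinity>) + cnj (h(0)) = 2 A\<close>. In the factor \<open>m - n + 2\<close>, the top
  coefficient contributes \<open>m - n + 1\<close> and \<open>f' 0\<close> contributes 1.\<close>

lemma coprime_complex_polyI:
  fixes p q :: "complex poly"
  assumes "\<And>z. poly p z = 0 \<Longrightarrow> poly q z \<noteq> 0"
  shows "coprime p q"
proof (rule coprimeI)
  fix d assume d: "d dvd p" "d dvd q"
  then have no_root: "poly d z \<noteq> 0" for z
    using assms[of z] by (auto elim!: dvdE)
  then have "degree d = 0"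
    using alg_closed_imp_poly_has_root[of d] by blast
  moreover have "d \<noteq> 0"
    using no_root[of 0] by auto
  ultimately show "is_unit d"
    by (simp add: is_unit_iff_degree)
qed

lemma coprime_polyE:
  fixes p q :: "complex poly"
  assumes "coprime p q"
  obtains u v where "u * p + v * q = 1"
  using assms bezout_coefficients_fst_snd[of p q] by auto

lemma coeff_mod_ge_degree:
  fixes p q :: "'a::field poly"
  assumes "q \<noteq> 0" "degree q \<le> i"
  shows "coeff (p mod q) i = 0"
  using degree_mod_less[OF assms(1), of p] assms(2) by (auto intro: coeff_eq_0)

lemma poly_eq_sum_atMost:
  fixes p :: "'a::comm_semiring_1 poly"
  assumes "degree p \<le> N"
  shows "poly p x = (\<Sum>i\<le>N. coeff p i * x ^ i)"
  unfolding poly_altdef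
  by (rule sum.mono_neutral_left) (use assms in \<open>auto intro: le_degree\<close>)

text \<open>Stated for power series because the time derivatives of the coefficients of
  \<open>P\<close> and \<open>Q\<close> are collected in series; vanishing above a bound is enough
  to read off the top coefficient of a product.\<close>

lemma fps_mult_nth_degree_bounds:
  fixes A B :: "'a::comm_semiring_1 fps"
  assumes "\<And>i. i > m \<Longrightarrow> fps_nth A i = 0" "\<And>i. i > n \<Longrightarrow> fps_nth B i = 0"
  shows "fps_nth (A * B) (m + n) = fps_nth A m * fps_nth B n"
proof -
  have "fps_nth (A * B) (m + n) = (\<Sum>i=0..m + n. fps_nth A i * fps_nth B (m + n - i))"
    by (rule fps_mult_nth)
  also have "\<dots> = (\<Sum>i\<in>{m}. fps_nth A i * fps_nth B (m + n - i))"
  proof (rule sum.mono_neutral_right)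
    show "\<forall>i\<in>{0..m + n} - {m}. fps_nth A i * fps_nth B (m + n - i) = 0"
    proof
      fix i assume "i \<in> {0..m + n} - {m}"
      then have "i > m \<or> m + n - i > n"
        by auto
      then show "fps_nth A i * fps_nth B (m + n - i) = 0"
        using assms by auto
    qed
  qed auto
  finally show ?thesis by simp
qed

lemma coeff_mult_degree_bounds:
  fixes p q :: "'a::comm_semiring_1 poly"
  assumes "degree p \<le> m" "degree q \<le> n"
  shows "coeff (p * q) (m + n) = coeff p m * coeff q n"
  using fps_mult_nth_degree_bounds[of m "fps_of_poly p" n "fps_of_poly q"] assms
  by (simp add: coeff_eq_0 flip: fps_of_poly_mult)

text \<open>The mirror image \<open>z ^ N * cnj (p (1 / cnj z))\<close> of \<open>p\<close> in the
  unit circle. \<open>N\<close> is a parameter because a polynomial of degree below \<open>N\<close>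
  may have to be reflected, such as \<open>B\<close> further on.\<close>

definition conj_reflect :: "nat \<Rightarrow> complex poly \<Rightarrow> complex poly" where
  "conj_reflect N p = (\<Sum>i\<le>N. monom (cnj (coeff p (N - i))) i)"

lemma coeff_conj_reflect:
  "coeff (conj_reflect N p) i = (if i \<le> N then cnj (coeff p (N - i)) else 0)"
  by (simp add: conj_reflect_def coeff_sum if_distrib cong: if_cong)

lemma degree_conj_reflect_le: "degree (conj_reflect N p) \<le> N"
  by (rule degree_le) (simp add: coeff_conj_reflect)

lemma poly_conj_reflect:
  assumes "degree p \<le> N" "z \<noteq> 0"
  shows "poly (conj_reflect N p) z = z ^ N * cnj (poly p (1 / cnj z))"
proof -
  have "poly (conj_reflect N p) z = (\<Sum>i\<le>N. cnj (coeff p (N - i)) * z ^ i)"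
    by (simp add: conj_reflect_def poly_sum poly_monom)
  also have "\<dots> = (\<Sum>i\<le>N. cnj (coeff p i) * z ^ (N - i))"
    by (rule sum.reindex_bij_witness[of _ "\<lambda>i. N - i" "\<lambda>i. N - i"]) auto
  also have "\<dots> = (\<Sum>i\<le>N. z ^ N * cnj (coeff p i * (1 / cnj z) ^ i))"
    using assms(2) by (intro sum.cong) (auto simp: power_diff power_divide)
  also have "\<dots> = z ^ N * cnj (poly p (1 / cnj z))"
    by (simp add: poly_eq_sum_atMost[OF assms(1)] sum_distrib_left)
  finally show ?thesis .
qed

lemma poly_conj_reflect_sphere:
  assumes "degree p \<le> N" "norm z = 1"
  shows "poly (conj_reflect N p) z = z ^ N * cnj (poly p z)"
proof -
  have "z \<noteq> 0" "z * cnj z = 1"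
    using assms(2) complex_norm_square[of z] by auto
  then have "1 / cnj z = z"
    by (metis complex_cnj_zero_iff nonzero_eq_divide_eq)
  then show ?thesis
    using poly_conj_reflect[OF assms(1), of z] \<open>z \<noteq> 0\<close> by simp
qed

text \<open>
  The fraction \<open>q |Q / P|\<^sup>2\<close> on the circle is a rational function whose poles are the roots of
  \<open>P\<close> and their mirror images; the part belonging to the roots of \<open>P\<close> gives \<open>C / P\<close>.
\<close>

lemma rational_with_real_part_on_circle:
  fixes P Q :: "complex poly" and q :: real
  assumes "n \<le> m" and P: "degree P = m" "\<And>z. norm z \<le> 1 \<Longrightarrow> poly P z \<noteq> 0"
    and Q: "degree Q = n"
  obtains C where "degree C \<le> m"
    "\<And>z. norm z = 1 \<Longrightarrow> Re (poly C z / poly P z) = q * (norm (poly Q z) / norm (poly P z))\<^sup>2"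
    "coeff C m / coeff P m = (if m = n then 2 * q * coeff Q n * cnj (coeff Q 0) /
       (coeff P m * cnj (coeff P 0)) else 0) - cnj (coeff C 0 / coeff P 0)"
proof -
  \<comment> \<open>On the circle \<open>P' = z ^ m * cnj P\<close> and
    \<open>N = z ^ m * q * |Q|^2\<close>, so \<open>N / (P * P')\<close> is the prescribed real
    part. The factor \<open>monom 1 (m - n)\<close> raises the power \<open>z ^ n\<close> from
    reflecting \<open>Q\<close> to \<open>z ^ m\<close>.\<close>
  define P' where "P' = conj_reflect m P"
  define N where "N = smult (of_real q) (monom 1 (m - n) * (Q * conj_reflect n Q))"
  have P0: "coeff P 0 \<noteq> 0"
    using P(2)[of 0] by (simp add: poly_0_coeff_0)
  then have "P \<noteq> 0" by auto
  then have Pm: "coeff P m \<noteq> 0"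
    using P(1) by auto
  \<comment> \<open>The roots of \<open>P\<close> lie outside the closed disk, so their mirror
    images, the roots of \<open>P'\<close>, lie inside.\<close>
  have "coprime P' P"
  proof (subst coprime_commute, rule coprime_complex_polyI)
    fix z assume z: "poly P z = 0"
    then have "norm z > 1" using P(2)[of z] by force
    then have "z \<noteq> 0" "norm (1 / cnj z) \<le> 1"
      by (auto simp: norm_divide divide_le_eq_1)
    then show "poly P' z \<noteq> 0"
      using P(2)[of "1 / cnj z"] P(1) by (simp add: P'_def poly_conj_reflect)
  qed
  then obtain U V where UV: "U * P' + V * P = 1"
    by (rule coprime_polyE)
  \<comment> \<open>Partial fractions \<open>N / (P * P') = A / P + B / P'\<close>. Taking the
    remainder modulo \<open>P\<close> makes \<open>A / P\<close> vanish at infinity, so the value at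
    infinity is carried by \<open>B / P'\<close>.\<close>
  define A where "A = (N * U) mod P"
  define B where "B = N * V + (N * U) div P * P'"
  have N_split: "N = A * P' + B * P"
  proof -
    have "N = N * (U * P' + V * P)"
      by (simp add: UV)
    also have "\<dots> = ((N * U) div P * P + A) * P' + N * V * P"
      by (simp add: A_def algebra_simps)
    finally show ?thesis
      by (simp add: B_def algebra_simps)
  qed
  have degP': "degree P' \<le> m"
    by (simp add: P'_def degree_conj_reflect_le)
  have Am: "coeff A m = 0"
    using \<open>P \<noteq> 0\<close> P(1) by (simp add: A_def coeff_mod_ge_degree)
  have degA: "degree A \<le> m"
    using degree_mod_less[OF \<open>P \<noteq> 0\<close>, of "N * U"] P(1) by (auto simp: A_def)
  have degQQ: "degree (Q * conj_reflect n Q) \<le> n + n"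
    using degree_mult_le[of Q "conj_reflect n Q"] degree_conj_reflect_le[of n Q] Q by linarith
  have degN': "degree N \<le> (m - n) + (n + n)"
  proof -
    have "degree (monom (1::complex) (m - n) * (Q * conj_reflect n Q)) \<le> (m - n) + (n + n)"
      using degree_mult_le[of "monom (1::complex) (m - n)" "Q * conj_reflect n Q"] degQQ
        degree_monom_le[of "1::complex" "m - n"] by linarith
    then show ?thesis
      unfolding N_def using degree_smult_le order_trans by blast
  qed
  then have degN: "degree N \<le> m + m"
    using \<open>n \<le> m\<close> by linarith
  have degB: "degree B \<le> m"
  proof (cases "B = 0")
    case False
    have "degree (A * P') \<le> m + m"
      using degree_mult_le[of A P'] degA degP' by linarith
    then have "degree (N - A * P') \<le> m + m"
      using degN degree_diff_le by blast
    then have "degree (B * P) \<le> m + m"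
      by (simp add: N_split)
    then show ?thesis
      using False \<open>P \<noteq> 0\<close> P(1) by (simp add: degree_mult_eq)
  qed auto
  \<comment> \<open>On the circle \<open>cnj (B / P')\<close> is
    \<open>conj_reflect m B / P\<close>. Conjugation keeps the real part and moves the poles from
    inside the disk to outside.\<close>
  define C where "C = A + conj_reflect m B"
  have Cm: "coeff C m = cnj (coeff B 0)" and C0: "coeff C 0 = coeff A 0 + cnj (coeff B m)"
    by (simp_all add: C_def Am coeff_conj_reflect)
  have N0: "coeff N 0 = coeff A 0 * cnj (coeff P m) + coeff B 0 * coeff P 0"
    by (simp add: N_split coeff_mult P'_def coeff_conj_reflect)
  have N2m: "coeff N (m + m) = coeff B m * coeff P m"
    using coeff_mult_degree_bounds[OF degA degP'] coeff_mult_degree_bounds[OF degB, of P m] P(1)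
    by (simp add: N_split Am)
  have N0': "coeff N 0 = (if m = n then q * coeff Q 0 * cnj (coeff Q n) else 0)"
    using \<open>n \<le> m\<close> by (auto simp: N_def coeff_mult coeff_conj_reflect)
  have N2m': "coeff N (m + m) = (if m = n then q * coeff Q n * cnj (coeff Q 0) else 0)"
  proof (cases "m = n")
    case True
    then show ?thesis
      using coeff_mult_degree_bounds[of Q n "conj_reflect n Q" n] Q degree_conj_reflect_le[of n Q]
      by (simp add: N_def coeff_conj_reflect)
  next
    case False
    then show ?thesis
      using degN' \<open>n \<le> m\<close> by (auto intro: coeff_eq_0)
  qed
  show thesis
  proof (rule that[of C])
    show "degree C \<le> m"
      unfolding C_def by (rule degree_add_le[OF degA degree_conj_reflect_le])
    show "Re (poly C z / poly P z) = q * (norm (poly Q z) / norm (poly P z))\<^sup>2"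
      if z: "norm z = 1" for z
    proof -
      define p where "p = poly P z"
      have p: "p \<noteq> 0" using P(2)[of z] z by (simp add: p_def)
      have zz: "z \<noteq> 0" "z * cnj z = 1"
        using z complex_norm_square[of z] by auto
      then have zm: "z ^ k * cnj z ^ k = 1" for k
        by (simp flip: power_mult_distrib)
      have cancel: "x = a * c + e' * b"
        if "e' * (e * x) = e' * (a * (e * c) + b)" "e * e' = 1" for e e' x a b c :: complex
        using that by algebra
      have "poly N z = q * (z ^ (m - n) * (poly Q z * (z ^ n * cnj (poly Q z))))"
        using z Q by (simp add: N_def poly_monom poly_conj_reflect_sphere)
      also have "\<dots> = z ^ m * (q * (poly Q z * cnj (poly Q z)))"
        using \<open>n \<le> m\<close> by (simp add: mult_ac flip: power_add)
      finally have "z ^ m * (q * (poly Q z * cnj (poly Q z)))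
          = poly A z * (z ^ m * cnj p) + poly B z * p"
        using z P(1) by (simp add: N_split P'_def poly_conj_reflect_sphere p_def)
      then have "cnj z ^ m * (z ^ m * (q * (poly Q z * cnj (poly Q z))))
          = cnj z ^ m * (poly A z * (z ^ m * cnj p) + poly B z * p)"
        by simp
      from cancel[OF this zm]
      have "q * (poly Q z * cnj (poly Q z)) = poly A z * cnj p + cnj z ^ m * poly B z * p"
        by (simp only: mult.assoc)
      then have "q * (poly Q z * cnj (poly Q z)) / (p * cnj p)
          = poly A z / p + cnj (z ^ m * cnj (poly B z) / p)"
        using p by (simp only: add_divide_distrib) simp
      also have "z ^ m * cnj (poly B z) = poly (conj_reflect m B) z"
        using z degB by (simp add: poly_conj_reflect_sphere)
      also have "q * (poly Q z * cnj (poly Q z)) / (p * cnj p)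
          = of_real (q * (norm (poly Q z) / norm p)\<^sup>2)"
        by (simp add: power_divide flip: complex_norm_square)
      finally have "q * (norm (poly Q z) / norm p)\<^sup>2
          = Re (poly A z / p + cnj (poly (conj_reflect m B) z / p))"
        by (metis Re_complex_of_real)
      also have "\<dots> = Re (poly C z / p)"
        by (simp only: C_def poly_add add_divide_distrib plus_complex.simps cnj.simps)
      finally show ?thesis by (simp add: p_def)
    qed
    \<comment> \<open>\<open>d / (coeff P m * cnj (coeff P 0))\<close> is the value of
      \<open>N / (P * P')\<close> at infinity. The two expressions for \<open>d\<close> come from
      the top and the conjugated bottom coefficient of \<open>N\<close>; adding them gives the
      reflection relation between \<open>C / P\<close> at infinity and at 0.\<close>
    define d where "d = (if m = n then q * coeff Q n * cnj (coeff Q 0) else 0)"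
    have 1: "d = coeff B m * coeff P m"
      using N2m N2m' by (simp add: d_def)
    have 2: "d = cnj (coeff A 0) * coeff P m + cnj (coeff B 0) * cnj (coeff P 0)"
      using arg_cong[OF N0, of cnj] unfolding N0' d_def by (auto simp: mult_ac split: if_splits)
    have "coeff C m / coeff P m + cnj (coeff C 0 / coeff P 0) = 2 * d / (coeff P m * cnj (coeff P 0))"
    proof -
      have "cnj (coeff B 0) * cnj (coeff P 0) + (cnj (coeff A 0) + coeff B m) * coeff P m = 2 * d"
        using 1 2 by (simp add: algebra_simps)
      moreover have "cnj (coeff P 0) \<noteq> 0"
        using P0 by simp
      ultimately show ?thesis
        using Pm by (simp only: Cm C0 complex_cnj_divide complex_cnj_add complex_cnj_cnj add_frac_eq not_False_eq_True)
    qed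
    then show "coeff C m / coeff P m = (if m = n then 2 * q * coeff Q n * cnj (coeff Q 0) /
       (coeff P m * cnj (coeff P 0)) else 0) - cnj (coeff C 0 / coeff P 0)"
      by (auto simp: d_def algebra_simps)
  qed
qed

section \<open>Holomorphic functions depending on time\<close>

lemma contour_integral_unit_circle:
  "contour_integral (circlepath 0 1) f = integral {0..2 * pi} (\<lambda>\<theta>. f (cis \<theta>) * \<i> * cis \<theta>)"
  by (simp add: circlepath_def contour_integral_part_circlepath_eq)

lemma circle_integral_has_vector_derivative:
  fixes F u :: "complex \<Rightarrow> real \<Rightarrow> complex"
  assumes T: "convex T" "t \<in> T"
    and der: "\<And>z s. z \<in> sphere 0 1 \<Longrightarrow> s \<in> T \<Longrightarrow> (F z has_vector_derivative u z s) (at s within T)"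
    and u: "continuous_on (sphere 0 1 \<times> T) (\<lambda>(z, s). u z s)"
    and F: "\<And>s. s \<in> T \<Longrightarrow> continuous_on (sphere 0 1) (\<lambda>z. F z s)"
    and h: "continuous_on (sphere 0 1) h"
  shows "((\<lambda>s. contour_integral (circlepath 0 1) (\<lambda>z. F z s * h z)) has_vector_derivative
           contour_integral (circlepath 0 1) (\<lambda>z. u z t * h z)) (at t within T)"
proof -
  have h': "continuous_on A (\<lambda>x. h (cis (\<theta> x)))" if "continuous_on A \<theta>" for \<theta> and A :: "'a::topological_space set"
    by (rule continuous_on_compose2[OF h]) (use that in \<open>auto intro!: continuous_intros\<close>)
  have "((\<lambda>s. integral (cbox 0 (2 * pi)) (\<lambda>\<theta>. F (cis \<theta>) s * h (cis \<theta>) * \<i> * cis \<theta>))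
      has_vector_derivative
      integral (cbox 0 (2 * pi)) (\<lambda>\<theta>. u (cis \<theta>) t * h (cis \<theta>) * \<i> * cis \<theta>)) (at t within T)"
  proof (rule leibniz_rule_vector_derivative[where U = T])
    show "((\<lambda>s. F (cis \<theta>) s * h (cis \<theta>) * \<i> * cis \<theta>) has_vector_derivative
        u (cis \<theta>) s * h (cis \<theta>) * \<i> * cis \<theta>) (at s within T)" if "s \<in> T" for s \<theta>
      by (intro has_vector_derivative_mult_left der) (use that in auto)
    show "(\<lambda>\<theta>. F (cis \<theta>) s * h (cis \<theta>) * \<i> * cis \<theta>) integrable_on cbox 0 (2 * pi)" if "s \<in> T" for s
      by (intro integrable_continuous continuous_intros continuous_on_compose2[OF F[OF that]] h') auto
    have "continuous_on (T \<times> cbox 0 (2 * pi)) (\<lambda>x. u (cis (snd x)) (fst x))"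
      using continuous_on_compose2[OF u, of "T \<times> cbox 0 (2 * pi)" "\<lambda>x. (cis (snd x), fst x)"]
      by (fastforce intro: continuous_intros)
    then show "continuous_on (T \<times> cbox 0 (2 * pi))
        (\<lambda>(s, \<theta>). u (cis \<theta>) s * h (cis \<theta>) * \<i> * cis \<theta>)"
      by (auto simp: case_prod_unfold intro!: continuous_intros h')
  qed (use T in auto)
  then show ?thesis
    by (simp add: contour_integral_unit_circle)
qed

context
  fixes F u :: "complex \<Rightarrow> real \<Rightarrow> complex" and T :: "real set" and t :: real
  assumes T: "convex T" "t \<in> T"
    and der: "\<And>z s. z \<in> cball 0 1 \<Longrightarrow> s \<in> T \<Longrightarrow> (F z has_vector_derivative u z s) (at s within T)"
    and u: "continuous_on (cball 0 1 \<times> T) (\<lambda>(z, s). u z s)"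
    and F: "\<And>s. s \<in> T \<Longrightarrow> continuous_on (cball 0 1) (\<lambda>z. F z s)"
      "\<And>s. s \<in> T \<Longrightarrow> (\<lambda>z. F z s) holomorphic_on ball 0 1"
begin

lemma circle_integral_deriv:
  assumes "continuous_on (sphere 0 1) h"
  shows "((\<lambda>s. contour_integral (circlepath 0 1) (\<lambda>z. F z s * h z)) has_vector_derivative
           contour_integral (circlepath 0 1) (\<lambda>z. u z t * h z)) (at t within T)"
proof (rule circle_integral_has_vector_derivative[OF T _ _ _ assms])
  show "continuous_on (sphere 0 1 \<times> T) (\<lambda>(z, s). u z s)"
    by (rule continuous_on_subset[OF u]) auto
  show "continuous_on (sphere 0 1) (\<lambda>z. F z s)" if "s \<in> T" for s
    by (rule continuous_on_subset[OF F(1)[OF that]]) auto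
qed (use der in auto)

lemma continuous_time_derivative: "continuous_on (cball 0 1) (\<lambda>z. u z t)"
  using continuous_on_compose2[OF u, of "cball 0 1" "\<lambda>z. (z, t)"] T
  by (fastforce intro: continuous_intros)

text \<open>Differentiating Cauchy's formula for \<open>F\<close> under the integral sign shows that
  \<open>u\<close> at time \<open>t\<close> is reproduced by Cauchy's formula from its values on the
  circle, and a Cauchy integral of a continuous function is holomorphic.\<close>

lemma holomorphic_time_derivative:
  assumes nontriv: "at t within T \<noteq> bot"
  shows "(\<lambda>z. u z t) holomorphic_on ball 0 1"
proof -
  have cont: "continuous_on (path_image (circlepath 0 1)) (\<lambda>z. u z t)"
    by (rule continuous_on_subset[OF continuous_time_derivative]) auto
  have rep: "((\<lambda>z. u z t / (z - w) ^ 1) has_contour_integral 2 * pi * \<i> * u w t) (circlepath 0 1)"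
    if w: "w \<in> ball 0 1" for w
  proof -
    have h: "continuous_on (sphere 0 1) (\<lambda>z. inverse (z - w))"
      using w by (intro continuous_intros) auto
    have "((\<lambda>s. 2 * pi * \<i> * F w s) has_vector_derivative
        contour_integral (circlepath 0 1) (\<lambda>z. u z t * inverse (z - w))) (at t within T)"
    proof (rule has_vector_derivative_transform[OF _ _ circle_integral_deriv[OF h]])
      show "2 * pi * \<i> * F w s = contour_integral (circlepath 0 1) (\<lambda>z. F z s * inverse (z - w))"
        if "s \<in> T" for s
        using contour_integral_unique[OF Cauchy_integral_circlepath[OF F[OF that], of w]] w
        by (simp add: divide_inverse)
    qed (use T in auto)
    moreover have "((\<lambda>s. 2 * pi * \<i> * F w s) has_vector_derivative 2 * pi * \<i> * u w t) (at t within T)"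
      by (intro has_vector_derivative_mult_right der) (use w T in auto)
    ultimately have "contour_integral (circlepath 0 1) (\<lambda>z. u z t * inverse (z - w)) = 2 * pi * \<i> * u w t"
      using vector_derivative_unique_within[OF nontriv] by blast
    moreover have "(\<lambda>z. u z t * inverse (z - w)) contour_integrable_on circlepath 0 1"
      unfolding circlepath_def
      by (intro contour_integrable_continuous_part_circlepath continuous_intros
          continuous_on_subset[OF continuous_time_derivative])
        (use w in \<open>auto simp flip: circlepath_def\<close>)
    ultimately show ?thesis
      using has_contour_integral_integral by (fastforce simp: divide_inverse)
  qed
  have "\<exists>d. ((\<lambda>z. u z t) has_field_derivative d) (at w)" if w: "w \<in> ball 0 1" for w
  proof -
    obtain d where "((\<lambda>z. 2 * pi * \<i> * u z t) has_field_derivative d) (at w)"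
      using Cauchy_next_derivative_circlepath(2)[OF cont rep _ w] by auto
    then have "((\<lambda>z. 2 * pi * \<i> * u z t / (2 * pi * \<i>)) has_field_derivative d / (2 * pi * \<i>)) (at w)"
      by (rule DERIV_cdivide)
    then show ?thesis by auto
  qed
  then show ?thesis
    by (simp add: holomorphic_on_open)
qed

text \<open>A Taylor coefficient at 0 is the integral of \<open>F\<close> over the circle against a
  fixed kernel, so it can be differentiated under the integral sign. This carries time
  differentiability of \<open>f\<close> over to its power series.\<close>

lemma taylor_coeff_has_vector_derivative:
  assumes nontriv: "at t within T \<noteq> bot"
  shows "((\<lambda>s. (deriv ^^ k) (\<lambda>z. F z s) 0 / fact k) has_vector_derivative
           (deriv ^^ k) (\<lambda>z. u z t) 0 / fact k) (at t within T)"
proof -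
  have h: "continuous_on (sphere 0 1) (\<lambda>z::complex. inverse (z ^ Suc k))"
    by (intro continuous_intros) auto
  have taylor: "(deriv ^^ k) f 0 / fact k
      = 1 / (2 * pi * \<i>) * contour_integral (circlepath 0 1) (\<lambda>z. f z * inverse (z ^ Suc k))"
    if "continuous_on (cball 0 1) f" "f holomorphic_on ball 0 1" for f
  proof -
    have "(deriv ^^ k) f 0 / fact k = 1 / (2 * pi * \<i>) * (2 * pi * \<i> * (deriv ^^ k) f 0 / fact k)"
      by simp
    also have "\<dots> = 1 / (2 * pi * \<i>) * contour_integral (circlepath 0 1) (\<lambda>z. f z / (z - 0) ^ Suc k)"
      by (subst Cauchy_contour_integral_circlepath[OF that]) auto
    finally show ?thesis
      unfolding divide_inverse[of "f _"] by simp
  qed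
  show ?thesis
  proof (rule has_vector_derivative_transform)
    show "((\<lambda>s. 1 / (2 * pi * \<i>) * contour_integral (circlepath 0 1) (\<lambda>z. F z s * inverse (z ^ Suc k)))
        has_vector_derivative (deriv ^^ k) (\<lambda>z. u z t) 0 / fact k) (at t within T)"
      unfolding taylor[OF continuous_time_derivative holomorphic_time_derivative[OF nontriv]]
      by (rule has_vector_derivative_mult_right[OF circle_integral_deriv[OF h]])
  qed (use T taylor F in auto)
qed

end

text \<open>Both \<open>exp w\<close> and \<open>exp (- w)\<close> have modulus 1 on the circle, so
  the maximum principle gives \<open>Re w = 0\<close> inside; a non-constant \<open>w\<close> would
  have an open image, which does not fit into the imaginary axis.\<close>

lemma imaginary_on_sphere_imp_constant:
  assumes cont: "continuous_on (cball 0 1) w" and hol: "w holomorphic_on ball 0 1"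
    and Re_0: "\<And>z. norm z = 1 \<Longrightarrow> Re (w z) = 0"
  obtains c :: real where "\<And>z. z \<in> ball 0 1 \<Longrightarrow> w z = \<i> * c"
proof -
  have "norm (exp (a * w z)) \<le> 1" if "z \<in> ball 0 1" "a = 1 \<or> a = -1" for z :: complex and a :: complex
    by (rule maximum_modulus_frontier[of _ "cball 0 1"])
      (use that Re_0 in \<open>auto intro!: continuous_intros holomorphic_intros cont hol\<close>)
  from this[of _ 1] this[of _ "-1"] have Re_0': "Re (w z) = 0" if "z \<in> ball 0 1" for z
    using that by force
  have "w constant_on ball 0 1"
  proof (rule ccontr)
    assume "\<not> w constant_on ball 0 1"
    then have "open (w ` ball 0 1)"
      using hol by (intro open_mapping_thm[where S = "ball 0 1"]) auto
    then obtain e where e: "e > 0" "ball (w 0) e \<subseteq> w ` ball 0 1"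
      by (metis centre_in_ball imageI open_contains_ball zero_less_one)
    then have "w 0 + of_real (e / 2) \<in> w ` ball 0 1"
      by (intro subsetD[OF e(2)]) (auto simp: dist_norm)
    then show False
      using e(1) Re_0' Re_0'[of 0] by (auto simp: complex_eq_iff)
  qed
  then obtain a where a: "\<And>z. z \<in> ball 0 1 \<Longrightarrow> w z = a"
    by (auto simp: constant_on_def)
  show thesis
    by (rule that[of "Im a"]) (use a Re_0'[of 0] in \<open>auto simp: complex_eq_iff\<close>)
qed

text \<open>Meant for the difference \<open>u\<close> of two velocities with the same boundary data,
  with \<open>g = f'\<close>: all that remains free is the infinitesimal rotation
  \<open>\<i> * c * z * f'\<close>.\<close>

lemma quotient_imaginary_on_sphere:
  assumes u: "continuous_on (cball 0 1) u" "u holomorphic_on ball 0 1" "u 0 = 0"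
    and g: "continuous_on (cball 0 1) g" "g holomorphic_on ball 0 1" "\<And>z. z \<in> cball 0 1 \<Longrightarrow> g z \<noteq> 0"
    and Re_0: "\<And>z. norm z = 1 \<Longrightarrow> Re (u z / (z * g z)) = 0"
  obtains c :: real where "\<And>z. z \<in> ball 0 1 \<Longrightarrow> u z = z * (g z * (\<i> * c))"
proof -
  define v where "v = (\<lambda>z. if z = 0 then deriv u 0 else (u z - u 0) / (z - 0))"
  have v_hol: "v holomorphic_on ball 0 1"
    unfolding v_def by (rule pole_lemma[OF u(2)]) auto
  \<comment> \<open>Holomorphy of \<open>v\<close> settles only the open disk, and \<open>u\<close>
    is merely continuous up to the circle. So 0 is treated through holomorphy and every other point
    through the quotient.\<close>
  have v_cont: "continuous_on (cball 0 1) v"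
  proof -
    have "continuous (at z within cball 0 1) v" if "z \<in> cball 0 1" for z
    proof (cases "z = 0")
      case True
      then have "isCont v z"
        using holomorphic_on_imp_continuous_on[OF v_hol]
        by (metis centre_in_ball continuous_on_eq_continuous_at open_ball zero_less_one)
      then show ?thesis
        by (rule continuous_at_imp_continuous_at_within)
    next
      case False
      have "continuous (at z within cball 0 1) (\<lambda>z. (u z - u 0) / (z - 0))"
        using u(1) that False by (intro continuous_intros) (auto simp: continuous_on_eq_continuous_within)
      then show ?thesis
        by (rule continuous_transform_within[where \<delta> = "norm z"])
          (use False that in \<open>auto simp: v_def dist_norm\<close>)
    qed
    then show ?thesis
      by (simp add: continuous_on_eq_continuous_within)
  qed
  have uv: "u z = z * v z" for z
    using u(3) by (auto simp: v_def)
  obtain c :: real where c: "\<And>z. z \<in> ball 0 1 \<Longrightarrow> v z / g z = \<i> * c"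
  proof (rule imaginary_on_sphere_imp_constant[of "\<lambda>z. v z / g z"])
    show "Re (v z / g z) = 0" if "norm z = 1" for z
      using Re_0[OF that] that uv[of z] by (cases "z = 0") auto
  qed (use v_cont v_hol g in \<open>auto intro!: continuous_intros holomorphic_intros\<close>)
  show thesis
  proof (rule that[of c])
    fix z :: complex assume "z \<in> ball 0 1"
    then show "u z = z * (g z * (\<i> * c))"
      using c[of z] g(3)[of z] uv[of z] by (auto simp: field_simps)
  qed
qed

section \<open>Time dependence of the coefficients of a rational function\<close>

lemma has_vector_derivative_iff_quotient:
  fixes f :: "real \<Rightarrow> 'a::real_normed_vector"
  shows "(f has_vector_derivative D) (at t within T) \<longleftrightarrow>
    ((\<lambda>s. (f s - f t) /\<^sub>R (s - t)) \<longlongrightarrow> D) (at t within T)"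
proof -
  have "(f has_vector_derivative D) (at t within T) \<longleftrightarrow>
      ((\<lambda>s. norm (f s - f t - (s - t) *\<^sub>R D) / norm (s - t)) \<longlongrightarrow> 0) (at t within T)"
    by (simp add: has_vector_derivative_def has_derivative_iff_norm bounded_linear_scaleR_left)
  also have "\<dots> \<longleftrightarrow> ((\<lambda>s. norm ((f s - f t) /\<^sub>R (s - t) - D)) \<longlongrightarrow> 0) (at t within T)"
  proof (rule filterlim_cong[OF refl refl])
    have "norm (f s - f t - (s - t) *\<^sub>R D) / norm (s - t) = norm ((f s - f t) /\<^sub>R (s - t) - D)"
      if "s \<noteq> t" for s
    proof -
      have "f s - f t - (s - t) *\<^sub>R D = (s - t) *\<^sub>R ((f s - f t) /\<^sub>R (s - t) - D)"
        using that by (simp add: scaleR_diff_right)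
      then show ?thesis
        using that by (simp only: norm_scaleR) simp
    qed
    then show "\<forall>\<^sub>F s in at t within T. norm (f s - f t - (s - t) *\<^sub>R D) / norm (s - t)
        = norm ((f s - f t) /\<^sub>R (s - t) - D)"
      by (auto simp: eventually_at_filter)
  qed
  also have "\<dots> \<longleftrightarrow> ((\<lambda>s. (f s - f t) /\<^sub>R (s - t)) \<longlongrightarrow> D) (at t within T)"
    by (simp add: tendsto_norm_zero_iff LIM_zero_iff)
  finally show ?thesis .
qed

text \<open>A product rule with \<open>u\<close> only continuous at \<open>t\<close>: the other
  factor vanishes there, so no derivative of \<open>u\<close> is met. It upgrades continuity of the
  coefficients of \<open>Q\<close> to differentiability.\<close>

lemma has_vector_derivative_mult_increment:
  fixes u v :: "real \<Rightarrow> 'a::real_normed_algebra"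
  assumes "(u \<longlongrightarrow> u t) (at t within T)" "(v has_vector_derivative v') (at t within T)"
  shows "((\<lambda>s. u s * (v s - v t)) has_vector_derivative u t * v') (at t within T)"
proof -
  have "((\<lambda>s. u s * ((v s - v t) /\<^sub>R (s - t))) \<longlongrightarrow> u t * v') (at t within T)"
    using assms by (intro tendsto_mult) (simp_all add: has_vector_derivative_iff_quotient)
  then show ?thesis
    by (simp add: has_vector_derivative_iff_quotient)
qed

lemma has_vector_derivative_divide:
  fixes f g :: "real \<Rightarrow> 'a::real_normed_field"
  assumes f: "(f has_vector_derivative f') (at t within T)"
    and g: "(g has_vector_derivative g') (at t within T)" and "g t \<noteq> 0"
  shows "((\<lambda>s. f s / g s) has_vector_derivative (f' - f t / g t * g') / g t) (at t within T)"
proof -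
  have "((\<lambda>s. inverse (g s)) has_vector_derivative g' * - (inverse (g t) * inverse (g t))) (at t within T)"
    using field_vector_diff_chain_within[OF g DERIV_inverse[OF \<open>g t \<noteq> 0\<close>]]
    by (simp add: o_def power2_eq_square)
  from has_vector_derivative_mult[OF f this] show ?thesis
    by (simp add: divide_inverse algebra_simps)
qed

text \<open>For fixed \<open>w\<close> and \<open>q\<close> the remainder is linear in
  \<open>p\<close>, so limits and time derivatives pass from the coefficients of \<open>p\<close> to
  those of the remainder.\<close>

lemma coeff_mult_mod_eq_sum:
  fixes p q w :: "'a::field poly"
  assumes "degree p \<le> N"
  shows "coeff ((w * p) mod q) i = (\<Sum>k\<le>N. coeff p k * coeff ((w * monom 1 k) mod q) i)"
proof -
  have lin: "coeff ((w * (\<Sum>k\<in>A. smult (c k) (monom 1 k))) mod q) i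
      = (\<Sum>k\<in>A. c k * coeff ((w * monom 1 k) mod q) i)" if "finite A" for A c
    using that by (induction A rule: finite_induct)
      (simp_all add: distrib_left poly_mod_add_left mod_smult_left)
  have "p = (\<Sum>k\<le>N. smult (coeff p k) (monom 1 k))"
    using poly_as_sum_of_monoms'[OF assms] by (simp add: smult_monom)
  then show ?thesis
    using lin[of "{..N}" "coeff p"] by simp
qed

text \<open>
  The polynomial \<open>S = Q t * P s - P t * Q s\<close> is \<open>Q t * Q s\<close> times the increment of \<open>P / Q\<close>.
  Multiplying it by a Bezout coefficient gives back \<open>Q s\<close> modulo \<open>Q t\<close>, which determines
  \<open>Q s\<close> since \<open>degree (Q s) \<le> degree (Q t)\<close> and \<open>Q s\<close> has constant term \<open>1\<close>. The bound
  on the coefficients yields continuity at \<open>t\<close> first, and then differentiability.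
\<close>

lemma denominator_coeffs_differentiable:
  fixes P Q :: "real \<Rightarrow> complex poly" and G :: "real \<Rightarrow> complex fps"
  assumes t: "t \<in> T"
    and deg: "\<And>s. s \<in> T \<Longrightarrow> degree (P s) \<le> m" "\<And>s. s \<in> T \<Longrightarrow> degree (Q s) \<le> n"
    and Q_0: "\<And>s. s \<in> T \<Longrightarrow> coeff (Q s) 0 = 1"
    and G: "\<And>s. s \<in> T \<Longrightarrow> fps_of_poly (Q s) * G s = fps_of_poly (P s)"
    and bounded: "\<And>s i. s \<in> T \<Longrightarrow> norm (coeff (Q s) i) \<le> K"
    and "coprime (P t) (Q t)" and Qt: "degree (Q t) = n"
    and G': "\<And>i. ((\<lambda>s. fps_nth (G s) i) has_vector_derivative G' i) (at t within T)"
  shows "\<exists>D. ((\<lambda>s. coeff (Q s) i) has_vector_derivative D) (at t within T)"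
proof -
  let ?F = "at t within T"
  have in_T: "\<forall>\<^sub>F s in ?F. s \<in> T"
    by (auto simp: eventually_at_filter)
  obtain U V where UV: "U * Q t + V * P t = 1"
    using coprime_polyE \<open>coprime (P t) (Q t)\<close> coprime_commute by metis
  define S where "S s = Q t * P s - P t * Q s" for s
  define R where "R s = (- V * S s) mod Q t" for s
  have Qt_nz: "Q t \<noteq> 0"
    using Q_0[OF t] by auto
  have degS: "degree (S s) \<le> m + n" if "s \<in> T" for s
    unfolding S_def
    using degree_mult_le[of "Q t" "P s"] degree_mult_le[of "P t" "Q s"] deg[OF that] deg[OF t]
    by (intro degree_diff_le) linarith+
  have coeff_S: "coeff (S s) k = (\<Sum>i\<le>k. coeff (Q t * Q s) i * (fps_nth (G s) (k - i) - fps_nth (G t) (k - i)))"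
    if "s \<in> T" for s k
  proof -
    have "fps_of_poly (S s) = fps_of_poly (Q t * Q s) * (G s - G t)"
      by (simp add: S_def fps_of_poly_diff fps_of_poly_mult algebra_simps flip: G[OF that] G[OF t])
    then have "fps_nth (fps_of_poly (S s)) k = fps_nth (fps_of_poly (Q t * Q s) * (G s - G t)) k"
      by simp
    then show ?thesis
      by (simp only: fps_mult_nth fps_of_poly_nth fps_sub_nth atLeast0AtMost)
  qed
  have coeff_R: "coeff (R s) i = (\<Sum>k\<le>m + n. coeff (S s) k * coeff ((- V * monom 1 k) mod Q t) i)"
    if "s \<in> T" for s i
    unfolding R_def by (rule coeff_mult_mod_eq_sum[OF degS[OF that]])
  have coeff_Q: "coeff (Q s) i = coeff (R s) i + (1 - coeff (R s) 0) * coeff (Q t) i"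
    if s: "s \<in> T" for s i
  proof -
    have "Q s = (U * Q t + V * P t) * Q s"
      by (simp add: UV)
    also have "\<dots> = - V * S s + (U * Q s + V * P s) * Q t"
      by (simp add: S_def algebra_simps)
    finally have "Q s mod Q t = (- V * S s + (U * Q s + V * P s) * Q t) mod Q t"
      by simp
    then have "Q s mod Q t = R s"
      by (simp add: R_def poly_mod_diff_left)
    moreover have "degree (Q s div Q t) = 0"
    proof -
      have "degree (Q s mod Q t) \<le> n"
        using degree_mod_less[OF Qt_nz, of "Q s"] Qt by auto
      then have "degree (Q s - Q s mod Q t) \<le> n"
        using deg(2)[OF s] by (intro degree_diff_le)
      then have "degree (Q s div Q t * Q t) \<le> n"
        by (simp add: minus_mod_eq_div_mult)
      then show ?thesis
        using Qt Qt_nz by (cases "Q s div Q t = 0") (simp_all add: degree_mult_eq)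
    qed
    ultimately obtain c where c: "Q s = [:c:] * Q t + R s"
      by (metis degree_eq_zeroE div_mult_mod_eq)
    then have "c = 1 - coeff (R s) 0"
      using Q_0[OF s] Q_0[OF t] by (simp add: eq_diff_eq)
    then show ?thesis
      using c by (metis add.commute coeff_add mult_pCons_left coeff_smult mult_zero_left pCons_0_0 add_0_right)
  qed
  have limR: "((\<lambda>s. coeff (R s) i) \<longlongrightarrow> 0) ?F" for i
  proof -
    have "((\<lambda>s. fps_nth (G s) j - fps_nth (G t) j) \<longlongrightarrow> 0) ?F" for j
      using has_vector_derivative_continuous[OF G'[of j]]
      by (simp add: continuous_within LIM_zero_iff)
    moreover have "\<forall>\<^sub>F s in ?F. norm (coeff (Q t * Q s) j) \<le> (\<Sum>l\<le>j. norm (coeff (Q t) l) * K)" for j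
      using in_T
    proof eventually_elim
      case (elim s)
      have "norm (coeff (Q t * Q s) j) \<le> (\<Sum>l\<le>j. norm (coeff (Q t) l * coeff (Q s) (j - l)))"
        unfolding coeff_mult by (rule norm_sum)
      also have "\<dots> \<le> (\<Sum>l\<le>j. norm (coeff (Q t) l) * K)"
        using bounded[OF elim] by (intro sum_mono) (simp add: norm_mult mult_left_mono)
      finally show ?case .
    qed
    ultimately have "((\<lambda>s. \<Sum>j\<le>k. coeff (Q t * Q s) j * (fps_nth (G s) (k - j) - fps_nth (G t) (k - j))) \<longlongrightarrow> 0) ?F" for k
      by (intro tendsto_null_sum lim_null_mult_left_bounded)
    then have "((\<lambda>s. coeff (S s) k) \<longlongrightarrow> 0) ?F" for k
      by (rule Lim_transform_eventually) (use in_T in eventually_elim, simp add: coeff_S)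
    then have "((\<lambda>s. \<Sum>k\<le>m + n. coeff (S s) k * coeff ((- V * monom 1 k) mod Q t) i) \<longlongrightarrow> 0) ?F"
      by (intro tendsto_null_sum tendsto_mult_left_zero)
    then show ?thesis
      by (rule Lim_transform_eventually) (use in_T in eventually_elim, simp add: coeff_R)
  qed
  have limQ: "((\<lambda>s. coeff (Q s) i) \<longlongrightarrow> coeff (Q t) i) ?F" for i
  proof -
    have "((\<lambda>s. coeff (R s) i + (1 - coeff (R s) 0) * coeff (Q t) i) \<longlongrightarrow> 0 + (1 - 0) * coeff (Q t) i) ?F"
      by (intro tendsto_intros limR)
    then have "((\<lambda>s. coeff (R s) i + (1 - coeff (R s) 0) * coeff (Q t) i) \<longlongrightarrow> coeff (Q t) i) ?F"
      by simp
    then show ?thesis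
      by (rule Lim_transform_eventually) (use in_T in eventually_elim, simp add: coeff_Q)
  qed
  have limQQ: "((\<lambda>s. coeff (Q t * Q s) i) \<longlongrightarrow> coeff (Q t * Q t) i) ?F" for i
    unfolding coeff_mult by (intro tendsto_intros limQ)
  \<comment> \<open>Continuity of \<open>Q s\<close> at \<open>t\<close> is now known, so the factor
    \<open>Q t * Q s\<close> enters the derivative frozen at \<open>s = t\<close>.\<close>
  define S' where "S' k = (\<Sum>i\<le>k. coeff (Q t * Q t) i * G' (k - i))" for k
  have S': "((\<lambda>s. coeff (S s) k) has_vector_derivative S' k) ?F" for k
    by (rule has_vector_derivative_transform[OF t coeff_S])
      (auto simp: S'_def intro!: has_vector_derivative_sum has_vector_derivative_mult_increment limQQ G')
  define R' where "R' i = (\<Sum>k\<le>m + n. S' k * coeff ((- V * monom 1 k) mod Q t) i)" for i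
  have R': "((\<lambda>s. coeff (R s) i) has_vector_derivative R' i) ?F" for i
    unfolding R'_def
    by (rule has_vector_derivative_transform[OF t coeff_R], assumption)
      (intro has_vector_derivative_sum has_vector_derivative_mult_left S')
  have "((\<lambda>s. coeff (R s) i + (1 - coeff (R s) 0) * coeff (Q t) i) has_vector_derivative
      R' i + (0 - R' 0) * coeff (Q t) i) ?F"
    by (intro has_vector_derivative_add has_vector_derivative_mult_left has_vector_derivative_diff
        has_vector_derivative_const R')
  from has_vector_derivative_transform[OF t coeff_Q this] show ?thesis
    by blast
qed

lemma fps_mult_has_vector_derivative:
  fixes A B :: "real \<Rightarrow> 'a::{real_normed_algebra, comm_semiring_1} fps"
  assumes "\<And>i. ((\<lambda>s. fps_nth (A s) i) has_vector_derivative fps_nth A' i) (at t within T)"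
    and "\<And>i. ((\<lambda>s. fps_nth (B s) i) has_vector_derivative fps_nth B' i) (at t within T)"
  shows "((\<lambda>s. fps_nth (A s * B s) i) has_vector_derivative fps_nth (A t * B' + A' * B t) i) (at t within T)"
  unfolding fps_mult_nth fps_add_nth sum.distrib[symmetric]
  by (intro has_vector_derivative_sum has_vector_derivative_mult assms)

section \<open>Continuous branches of logarithm and argument\<close>

text \<open>Near \<open>s = t\<close> the quotient is close to 1 and so away from the cut of
  \<open>Ln\<close>, whatever the argument of \<open>W t\<close>.\<close>

lemma Ln_quotient_has_vector_derivative:
  fixes W :: "real \<Rightarrow> complex"
  assumes "(W has_vector_derivative W') (at t within T)" "W t \<noteq> 0"
  shows "((\<lambda>s. Ln (W s / W t)) has_vector_derivative W' / W t) (at t within T)"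
proof -
  have "((\<lambda>w. Ln (w / W t)) has_field_derivative inverse (W t)) (at (W t) within W ` T)"
    using assms(2) by (auto intro!: derivative_eq_intros simp: divide_inverse)
  from field_vector_diff_chain_within[OF assms(1) this] show ?thesis
    by (simp add: o_def divide_inverse)
qed

text \<open>By continuity \<open>L s - L t\<close> has imaginary part below pi in modulus for
  \<open>s\<close> near \<open>t\<close>, so it equals \<open>Ln (W s / W t)\<close>.\<close>

lemma continuous_log_has_vector_derivative:
  fixes W :: "real \<Rightarrow> complex"
  assumes t: "t \<in> T" and W': "(W has_vector_derivative W') (at t within T)"
    and L: "continuous_on T L" "\<And>s. s \<in> T \<Longrightarrow> exp (L s) = W s"
  shows "(L has_vector_derivative W' / W t) (at t within T)"
proof -
  obtain d where d: "d > 0" "\<And>s. s \<in> T \<Longrightarrow> dist s t < d \<Longrightarrow> dist (L s) (L t) < pi"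
    using L(1) t pi_gt_zero unfolding continuous_on_iff by meson
  have W_t: "W t \<noteq> 0"
    using L(2)[OF t] by (metis exp_not_eq_zero)
  have "((\<lambda>s. L t + Ln (W s / W t)) has_vector_derivative 0 + W' / W t) (at t within T)"
    by (intro has_vector_derivative_add has_vector_derivative_const
        Ln_quotient_has_vector_derivative[OF W' W_t])
  then have "((\<lambda>s. L t + Ln (W s / W t)) has_vector_derivative W' / W t) (at t within T)"
    by simp
  then show ?thesis
  proof (rule has_vector_derivative_transform_within[OF _ d(1) t])
    fix s assume s: "s \<in> T" "dist s t < d"
    have "\<bar>Im (L s - L t)\<bar> < pi"
      using d(2)[OF s] abs_Im_le_cmod[of "L s - L t"] by (simp add: dist_norm)
    then have "Ln (exp (L s - L t)) = L s - L t"
      by (intro Ln_exp) auto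
    then show "L t + Ln (W s / W t) = L s"
      using L(2)[OF s(1)] L(2)[OF t] by (simp add: exp_diff)
  qed
qed

lemma ln_norm_has_vector_derivative:
  fixes W :: "real \<Rightarrow> complex"
  assumes t: "t \<in> T" and W': "(W has_vector_derivative W') (at t within T)"
    and W: "\<And>s. s \<in> T \<Longrightarrow> W s \<noteq> 0"
  shows "((\<lambda>s. ln (norm (W s))) has_vector_derivative Re (W' / W t)) (at t within T)"
proof (rule has_vector_derivative_transform[OF t])
  show "ln (norm (W s)) = ln (norm (W t)) + Re (Ln (W s / W t))" if "s \<in> T" for s
    using W[OF that] W[OF t] by (simp add: norm_divide ln_div)
  have "((\<lambda>s. ln (norm (W t)) + Re (Ln (W s / W t))) has_vector_derivative 0 + Re (W' / W t)) (at t within T)"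
    by (intro has_vector_derivative_add has_vector_derivative_const
        bounded_linear.has_vector_derivative[OF bounded_linear_Re]
        Ln_quotient_has_vector_derivative[OF W' W[OF t]])
  then show "((\<lambda>s. ln (norm (W t)) + Re (Ln (W s / W t))) has_vector_derivative Re (W' / W t)) (at t within T)"
    by simp
qed

text \<open>Together with \<open>ln (norm (W s))\<close> a continuous argument forms a continuous
  logarithm; its imaginary part is differentiated.\<close>

lemma continuous_arg_has_vector_derivative:
  fixes W :: "real \<Rightarrow> complex"
  assumes t: "t \<in> T" and W': "\<And>s. s \<in> T \<Longrightarrow> (W has_vector_derivative W' s) (at s within T)"
    and W: "\<And>s. s \<in> T \<Longrightarrow> W s \<noteq> 0"
    and \<Theta>: "continuous_on T \<Theta>" "\<And>s. s \<in> T \<Longrightarrow> W s = of_real (norm (W s)) * cis (\<Theta> s)"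
  shows "(\<Theta> has_vector_derivative Im (W' t / W t)) (at t within T)"
proof -
  define L where "L s = complex_of_real (ln (norm (W s))) + \<i> * of_real (\<Theta> s)" for s
  have "continuous_on T W"
    using W' by (meson continuous_on_vector_derivative)
  then have "continuous_on T L"
    unfolding L_def using W \<Theta>(1) by (intro continuous_intros) auto
  moreover have "exp (L s) = W s" if "s \<in> T" for s
    using \<Theta>(2)[OF that] W[OF that] by (simp add: L_def exp_add exp_of_real cis_conv_exp)
  ultimately have "(L has_vector_derivative W' t / W t) (at t within T)"
    by (rule continuous_log_has_vector_derivative[OF t W'[OF t]])
  then have "((\<lambda>s. Im (L s)) has_vector_derivative Im (W' t / W t)) (at t within T)"
    by (rule bounded_linear.has_vector_derivative[OF bounded_linear_Im])
  then show ?thesis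
    by (simp add: L_def)
qed

text \<open>Exponentiating erases the choice of branches and of the labelling: only the product of
  all roots remains, and it can be differentiated without following single roots.\<close>

lemma exp_continuous_log_sum:
  assumes "continuous_log_sum T N z L" "t \<in> T"
  shows "exp (L t) = (\<Prod>k<N. z k t)"
proof -
  obtain l where "\<And>k. k < N \<Longrightarrow> exp (l k) = z k t" "L t = (\<Sum>k<N. l k)"
    using assms unfolding continuous_log_sum_def by blast
  then show ?thesis
    by (simp add: exp_sum)
qed

lemma cis_sum: "cis (\<Sum>k\<in>A. \<theta> k) = (\<Prod>k\<in>A. cis (\<theta> k))"
  by (induction A rule: infinite_finite_induct) (simp_all flip: cis_mult)

lemma cis_continuous_arg_sum:
  assumes "continuous_arg_sum T N z \<Theta>" "t \<in> T"
  shows "(\<Prod>k<N. z k t) = of_real (norm (\<Prod>k<N. z k t)) * cis (\<Theta> t)"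
proof -
  obtain \<theta> where \<theta>: "\<And>k. k < N \<Longrightarrow> z k t = of_real (norm (z k t)) * cis (\<theta> k)"
    and \<Theta>: "\<Theta> t = (\<Sum>k<N. \<theta> k)"
    using assms unfolding continuous_arg_sum_def by blast
  have "(\<Prod>k<N. z k t) = (\<Prod>k<N. of_real (norm (z k t)) * cis (\<theta> k))"
    by (rule prod.cong) (use \<theta> in auto)
  then show ?thesis
    unfolding \<Theta> cis_sum prod_norm[symmetric] of_real_prod prod.distrib[symmetric] .
qed

section \<open>The Polubarinova-Galin equation with rational derivative\<close>

lemma mean_of_real_part_on_circle:
  assumes "continuous_on (cball 0 1) h" "h holomorphic_on ball 0 1"
  shows "Re (h 0) = 1 / (2 * pi) * integral {0..2 * pi} (\<lambda>\<theta>. Re (h (cis \<theta>)))"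
proof -
  have int: "(\<lambda>\<theta>. h (cis \<theta>)) integrable_on {0..2 * pi}"
    by (intro integrable_continuous_real continuous_on_compose2[OF assms(1)] continuous_intros) auto
  have "2 * pi * \<i> * h 0 = contour_integral (circlepath 0 1) (\<lambda>z. h z / (z - 0))"
    using contour_integral_unique[OF Cauchy_integral_circlepath[OF assms, of 0]] by simp
  also have "\<dots> = integral {0..2 * pi} (\<lambda>\<theta>. \<i> * h (cis \<theta>))"
    unfolding contour_integral_unit_circle by (intro integral_cong) auto
  also have "\<dots> = \<i> * integral {0..2 * pi} (\<lambda>\<theta>. h (cis \<theta>))"
    by simp
  finally have "2 * pi * h 0 = integral {0..2 * pi} (\<lambda>\<theta>. h (cis \<theta>))"
    by (simp add: mult.assoc)
  then have "Re (2 * pi * h 0) = integral {0..2 * pi} (\<lambda>\<theta>. Re (h (cis \<theta>)))"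
    using integral_linear[OF int bounded_linear_Re] by (simp add: o_def)
  then show ?thesis
    by (simp add: field_simps)
qed

lemma has_fps_expansion_unique:
  fixes f :: "complex \<Rightarrow> complex"
  assumes "f has_fps_expansion F" "f has_fps_expansion G"
  shows "F = G"
  using assms by (simp add: fps_eq_iff fps_nth_fps_expansion)

lemma has_fps_expansion_poly: "poly p has_fps_expansion fps_of_poly p"
  by (simp add: has_fps_expansion_def)

lemma has_fps_expansion_transform_ball:
  assumes "f has_fps_expansion F" "r > 0" "\<And>z. z \<in> ball 0 r \<Longrightarrow> f z = g z"
  shows "g has_fps_expansion F"
proof -
  have "\<forall>\<^sub>F z in nhds 0. f z = g z"
    using assms(2,3) by (auto simp: eventually_nhds intro!: exI[of _ "ball 0 r"])
  then show ?thesis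
    using assms(1) unfolding has_fps_expansion_def
    by (auto elim: eventually_elim2)
qed

text \<open>The fraction \<open>z * C / Q\<close> built from the prescribed real part meets the same
  boundary condition as \<open>u\<close>, so the two differ by a rotation
  \<open>\<i> * c * z * P / Q\<close>, which is absorbed into \<open>C\<close>.\<close>

lemma rational_velocity:
  fixes P Q :: "complex poly" and q :: real
  assumes "n \<le> m" and P: "degree P = m" "\<And>z. norm z \<le> 1 \<Longrightarrow> poly P z \<noteq> 0"
    and Q: "degree Q = n" "\<And>z. norm z \<le> 1 \<Longrightarrow> poly Q z \<noteq> 0"
    and u: "continuous_on (cball 0 1) u" "u holomorphic_on ball 0 1" "u 0 = 0"
    and eq: "\<And>z. norm z = 1 \<Longrightarrow> Re (u z * cnj (z * (poly P z / poly Q z))) = q"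
  obtains C where "degree C \<le> m"
    "\<And>z. z \<in> ball 0 1 \<Longrightarrow> poly Q z * u z = z * poly C z"
    "\<And>z. norm z = 1 \<Longrightarrow> Re (poly C z / poly P z) = q / (norm (poly P z / poly Q z))\<^sup>2"
    "coeff C m / coeff P m = (if m = n then 2 * q * coeff Q n * cnj (coeff Q 0) /
       (coeff P m * cnj (coeff P 0)) else 0) - cnj (coeff C 0 / coeff P 0)"
proof -
  obtain C where C: "degree C \<le> m"
    "\<And>z. norm z = 1 \<Longrightarrow> Re (poly C z / poly P z) = q * (norm (poly Q z) / norm (poly P z))\<^sup>2"
    "coeff C m / coeff P m = (if m = n then 2 * q * coeff Q n * cnj (coeff Q 0) /
       (coeff P m * cnj (coeff P 0)) else 0) - cnj (coeff C 0 / coeff P 0)"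
    using rational_with_real_part_on_circle[OF \<open>n \<le> m\<close> P Q(1)] by metis
  have coeff_nz: "coeff P 0 \<noteq> 0" "coeff P m \<noteq> 0"
    using P(2)[of 0] P(1) by (auto simp: poly_0_coeff_0)
  define g where "g z = poly P z / poly Q z" for z
  define D where "D z = u z - z * (poly C z / poly Q z)" for z
  obtain c :: real where c: "\<And>z. z \<in> ball 0 1 \<Longrightarrow> D z = z * (g z * (\<i> * c))"
  proof (rule quotient_imaginary_on_sphere[of D g])
    show "continuous_on (cball 0 1) D" "D holomorphic_on ball 0 1"
      "continuous_on (cball 0 1) g" "g holomorphic_on ball 0 1"
      unfolding D_def g_def using u Q(2) by (auto intro!: continuous_intros holomorphic_intros)
    show "D 0 = 0" "\<And>z. z \<in> cball 0 1 \<Longrightarrow> g z \<noteq> 0"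
      using u(3) P(2) Q(2) by (auto simp: D_def g_def)
    fix z :: complex assume z: "norm z = 1"
    then have nz: "z \<noteq> 0" "poly P z \<noteq> 0" "poly Q z \<noteq> 0"
      using P(2)[of z] Q(2)[of z] by auto
    have "u z / (z * g z) = u z * cnj (z * g z) / (z * g z * cnj (z * g z))"
      using nz by (simp add: g_def)
    also have "z * g z * cnj (z * g z) = of_real ((norm (g z))\<^sup>2)"
      using z by (metis complex_norm_square norm_mult mult_1)
    finally have "Re (u z / (z * g z)) = q / (norm (g z))\<^sup>2"
      using eq[OF z] by (simp only: g_def Re_divide_of_real)
    moreover have "z * (poly C z / poly Q z) / (z * g z) = poly C z / poly P z"
      using nz by (simp add: g_def)
    then have "D z / (z * g z) = u z / (z * g z) - poly C z / poly P z"
      by (simp only: D_def diff_divide_distrib)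
    ultimately show "Re (D z / (z * g z)) = 0"
      using C(2)[OF z] nz by (simp add: g_def norm_divide power_divide)
  qed (erule that)
  \<comment> \<open>The relation between the values of \<open>C / P\<close> at 0 and at infinity
    survives the change because \<open>- cnj (\<i> * c) = \<i> * c\<close> for real
    \<open>c\<close>.\<close>
  define C' where "C' = C + smult (\<i> * c) P"
  show thesis
  proof (rule that[of C'])
    show "degree C' \<le> m"
      unfolding C'_def using C(1) P(1) degree_smult_le[of "\<i> * c" P] by (intro degree_add_le) auto
    show "poly Q z * u z = z * poly C' z" if z: "z \<in> ball 0 1" for z
    proof -
      have Qz: "poly Q z \<noteq> 0"
        using Q(2)[of z] z by auto
      have "u z = z * (poly C z / poly Q z) + z * (g z * (\<i> * c))"
        using c[OF z] by (simp add: D_def algebra_simps)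
      then show ?thesis
        using Qz by (simp add: C'_def g_def distrib_left)
    qed
    show "Re (poly C' z / poly P z) = q / (norm (poly P z / poly Q z))\<^sup>2" if z: "norm z = 1" for z
    proof -
      have "poly C' z / poly P z = poly C z / poly P z + \<i> * c"
        using P(2)[of z] z by (simp add: C'_def add_divide_distrib)
      then show ?thesis
        using C(2)[OF z] by (simp add: norm_divide power_divide)
    qed
    have "coeff C' i / coeff P i = coeff C i / coeff P i + \<i> * c" if "coeff P i \<noteq> 0" for i
      using that by (simp add: C'_def add_divide_distrib)
    then show "coeff C' m / coeff P m = (if m = n then 2 * q * coeff Q n * cnj (coeff Q 0) /
        (coeff P m * cnj (coeff P 0)) else 0) - cnj (coeff C' 0 / coeff P 0)"
      using C(3) coeff_nz by simp
  qed
qed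

text \<open>A power series identity at 0 that holds at all times can be differentiated coefficient
  by coefficient. In the differentiated identity the constant term yields \<open>P0'\<close>, and
  the coefficient of index \<open>m + n\<close> yields the relation between \<open>Pm'\<close> and
  \<open>Qn'\<close>.\<close>

lemma rational_solution_coeff_derivatives:
  fixes F u :: "complex \<Rightarrow> real \<Rightarrow> complex" and P Q :: "real \<Rightarrow> complex poly" and q :: real
  assumes T: "convex T" "t \<in> T" "at t within T \<noteq> bot"
    and der: "\<And>z s. z \<in> cball 0 1 \<Longrightarrow> s \<in> T \<Longrightarrow> (F z has_vector_derivative u z s) (at s within T)"
    and u: "continuous_on (cball 0 1 \<times> T) (\<lambda>(z, s). u z s)"
    and F: "\<And>s. s \<in> T \<Longrightarrow> (\<lambda>z. F z s) analytic_on cball 0 1" "\<And>s. s \<in> T \<Longrightarrow> F 0 s = 0"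
    and "n \<le> m"
    and P: "\<And>s. s \<in> T \<Longrightarrow> degree (P s) = m" "\<And>s. s \<in> T \<Longrightarrow> Im (coeff (P s) 0) = 0"
    and Q: "\<And>s. s \<in> T \<Longrightarrow> degree (Q s) = n" "\<And>s. s \<in> T \<Longrightarrow> coeff (Q s) 0 = 1"
      "\<And>s i. s \<in> T \<Longrightarrow> norm (coeff (Q s) i) \<le> K"
    and nz: "\<And>z. norm z \<le> 1 \<Longrightarrow> poly (P t) z \<noteq> 0" "\<And>s z. s \<in> T \<Longrightarrow> norm z \<le> 1 \<Longrightarrow> poly (Q s) z \<noteq> 0"
    and "coprime (P t) (Q t)"
    and deriv_F: "\<And>s z. s \<in> T \<Longrightarrow> z \<in> ball 0 1 \<Longrightarrow> deriv (\<lambda>z. F z s) z = poly (P s) z / poly (Q s) z"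
    and eq: "\<And>z. norm z = 1 \<Longrightarrow> Re (u z t * cnj (z * (poly (P t) z / poly (Q t) z))) = q"
  defines "\<mu> \<equiv> 1 / (2 * pi) * integral {0..2 * pi}
      (\<lambda>\<theta>. q / (norm (poly (P t) (cis \<theta>) / poly (Q t) (cis \<theta>)))\<^sup>2)"
  obtains P0' Pm' Qn' where
    "((\<lambda>s. coeff (P s) 0) has_vector_derivative P0') (at t within T)"
    "((\<lambda>s. coeff (P s) m) has_vector_derivative Pm') (at t within T)"
    "((\<lambda>s. coeff (Q s) n) has_vector_derivative Qn') (at t within T)"
    "P0' / coeff (P t) 0 = of_real \<mu>"
    "Pm' / coeff (P t) m - Qn' / coeff (Q t) n = of_nat (m - n + 1) *
       ((if m = n then 2 * q * coeff (Q t) n / (coeff (P t) m * coeff (P t) 0) else 0) - of_real \<mu>)"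
proof -
  let ?F = "at t within T"
  have F': "continuous_on (cball 0 1) (\<lambda>z. F z s)" "(\<lambda>z. F z s) holomorphic_on ball 0 1"
    if "s \<in> T" for s
    using analytic_imp_holomorphic[OF F(1)[OF that]]
    by (auto intro: holomorphic_on_imp_continuous_on holomorphic_on_subset)
  note circle = T(1,2) der u F'
  have ut: "continuous_on (cball 0 1) (\<lambda>z. u z t)" "(\<lambda>z. u z t) holomorphic_on ball 0 1"
    by (rule continuous_time_derivative[OF circle] holomorphic_time_derivative[OF circle T(3)]; assumption)+
  have u0: "u 0 t = 0"
  proof (rule vector_derivative_unique_within[OF T(3)])
    show "(F 0 has_vector_derivative u 0 t) ?F"
      using der T(2) by simp
    show "(F 0 has_vector_derivative 0) ?F"
      by (rule has_vector_derivative_transform[OF T(2) _ has_vector_derivative_const]) (rule F(2))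
  qed
  obtain C where C: "degree C \<le> m"
    "\<And>z. z \<in> ball 0 1 \<Longrightarrow> poly (Q t) z * u z t = z * poly C z"
    "\<And>z. norm z = 1 \<Longrightarrow> Re (poly C z / poly (P t) z) = q / (norm (poly (P t) z / poly (Q t) z))\<^sup>2"
    "coeff C m / coeff (P t) m = (if m = n then 2 * q * coeff (Q t) n * cnj (coeff (Q t) 0) /
       (coeff (P t) m * cnj (coeff (P t) 0)) else 0) - cnj (coeff C 0 / coeff (P t) 0)"
    using rational_velocity[OF \<open>n \<le> m\<close> P(1)[OF T(2)] nz(1) Q(1)[OF T(2)] nz(2)[OF T(2)] ut u0 eq] by metis
  define \<Phi> where "\<Phi> s = fps_expansion (\<lambda>z. F z s) 0" for s
  define U where "U = fps_expansion (\<lambda>z. u z t) 0"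
  have U: "(\<lambda>z. u z t) has_fps_expansion U"
    unfolding U_def by (rule has_fps_expansion_fps_expansion[OF _ _ ut(2)]) auto
  have \<Phi>: "(\<lambda>z. F z s) has_fps_expansion \<Phi> s" if "s \<in> T" for s
    unfolding \<Phi>_def by (rule has_fps_expansion_fps_expansion[OF _ _ F'(2)[OF that]]) auto
  have G: "fps_of_poly (Q s) * fps_deriv (\<Phi> s) = fps_of_poly (P s)" if s: "s \<in> T" for s
  proof (rule has_fps_expansion_unique[OF _ has_fps_expansion_poly])
    show "poly (P s) has_fps_expansion fps_of_poly (Q s) * fps_deriv (\<Phi> s)"
    proof (rule has_fps_expansion_transform_ball[where r = 1])
      show "(\<lambda>z. poly (Q s) z * deriv (\<lambda>z. F z s) z) has_fps_expansion
          fps_of_poly (Q s) * fps_deriv (\<Phi> s)"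
        by (intro has_fps_expansion_mult has_fps_expansion_poly has_fps_expansion_deriv \<Phi> s)
    qed (use deriv_F[OF s] nz(2)[OF s] in auto)
  qed
  have QU: "fps_of_poly (Q t) * U = fps_X * fps_of_poly C"
  proof (rule has_fps_expansion_unique)
    show "(\<lambda>z. z * poly C z) has_fps_expansion fps_X * fps_of_poly C"
      by (intro has_fps_expansion_mult has_fps_expansion_fps_X has_fps_expansion_poly)
    show "(\<lambda>z. z * poly C z) has_fps_expansion fps_of_poly (Q t) * U"
    proof (rule has_fps_expansion_transform_ball[where r = 1])
      show "(\<lambda>z. poly (Q t) z * u z t) has_fps_expansion fps_of_poly (Q t) * U"
        by (intro has_fps_expansion_mult has_fps_expansion_poly U)
    qed (use C(2) in auto)
  qed
  have \<Phi>': "((\<lambda>s. fps_nth (\<Phi> s) i) has_vector_derivative fps_nth U i) ?F" for i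
    unfolding \<Phi>_def U_def fps_expansion_def fps_nth_Abs_fps
    by (rule taylor_coeff_has_vector_derivative[OF circle T(3)])
  have G': "((\<lambda>s. fps_nth (fps_deriv (\<Phi> s)) i) has_vector_derivative fps_nth (fps_deriv U) i) ?F" for i
    unfolding fps_deriv_nth by (intro has_vector_derivative_mult_right \<Phi>')
  have "\<exists>D. ((\<lambda>s. coeff (Q s) i) has_vector_derivative D) ?F" for i
    by (rule denominator_coeffs_differentiable[OF T(2) _ _ Q(2) G Q(3) \<open>coprime (P t) (Q t)\<close> Q(1)[OF T(2)] G'])
      (use P(1) Q(1) in auto)
  then obtain Q' where Q': "\<And>i. ((\<lambda>s. coeff (Q s) i) has_vector_derivative Q' i) ?F"
    by metis
  \<comment> \<open>The coefficients of \<open>Q s\<close> with these indices are constant in time,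
    namely 1 or 0, so \<open>Abs_fps Q'\<close> behaves like a polynomial of degree at most
    \<open>n\<close> without constant term.\<close>
  have Q'_0: "Q' i = 0" if "i = 0 \<or> i > n" for i
  proof (rule vector_derivative_unique_within[OF T(3) Q'])
    show "((\<lambda>s. coeff (Q s) i) has_vector_derivative 0) ?F"
      by (rule has_vector_derivative_transform[OF T(2) _ has_vector_derivative_const[of "coeff (Q t) i"]])
        (use that Q(1,2) T(2) in \<open>auto simp: coeff_eq_0\<close>)
  qed
  define P' where "P' = fps_of_poly (Q t) * fps_deriv U + Abs_fps Q' * fps_deriv (\<Phi> t)"
  have P': "((\<lambda>s. coeff (P s) i) has_vector_derivative fps_nth P' i) ?F" for i
  proof (rule has_vector_derivative_transform[OF T(2)])
    show "coeff (P s) i = fps_nth (fps_of_poly (Q s) * fps_deriv (\<Phi> s)) i" if "s \<in> T" for s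
      by (simp add: G[OF that])
    show "((\<lambda>s. fps_nth (fps_of_poly (Q s) * fps_deriv (\<Phi> s)) i) has_vector_derivative fps_nth P' i) ?F"
      unfolding P'_def
      by (rule fps_mult_has_vector_derivative) (simp_all add: Q' G' del: fps_deriv_nth)
  qed
  have P'_0: "fps_nth P' i = 0" if "i > m" for i
  proof (rule vector_derivative_unique_within[OF T(3) P'])
    show "((\<lambda>s. coeff (P s) i) has_vector_derivative 0) ?F"
      by (rule has_vector_derivative_transform[OF T(2) _ has_vector_derivative_const[of 0]])
        (use that P(1) in \<open>auto simp: coeff_eq_0\<close>)
  qed
  text \<open>The time derivative of \<open>P / Q\<close> is the space derivative of \<open>z C / Q\<close>.\<close>
  have key: "P' * fps_of_poly (Q t) - Abs_fps Q' * fps_of_poly (P t)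
      = fps_of_poly (Q t) * fps_of_poly (pderiv (pCons 0 C)) - fps_of_poly (pCons 0 (pderiv (Q t))) * fps_of_poly C"
  proof -
    have 1: "fps_deriv (fps_of_poly (Q t)) * U + fps_of_poly (Q t) * fps_deriv U
        = fps_of_poly (pderiv (pCons 0 C))"
      using arg_cong[OF QU, of fps_deriv] by (simp add: fps_of_poly_pderiv fps_of_poly_pCons mult.commute add.commute)
    have 2: "fps_of_poly (pCons 0 (pderiv (Q t))) = fps_X * fps_deriv (fps_of_poly (Q t))"
      by (simp add: fps_of_poly_pderiv fps_of_poly_pCons mult.commute)
    have "fps_of_poly (pCons 0 (pderiv (Q t))) * fps_of_poly C
        = fps_deriv (fps_of_poly (Q t)) * (fps_of_poly (Q t) * U)"
      unfolding 2 QU by (simp only: mult_ac)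
    then show ?thesis
      unfolding P'_def 1[symmetric] G[OF T(2), symmetric] by (simp only: algebra_simps)
  qed
  have nz_coeffs: "coeff (P t) 0 \<noteq> 0" "coeff (P t) m \<noteq> 0" "coeff (Q t) n \<noteq> 0"
    using nz(1)[of 0] P(1)[OF T(2)] Q(1,2)[OF T(2)] by (auto simp: poly_0_coeff_0)
  \<comment> \<open>In the constant term of \<open>key\<close> the products with
    \<open>Abs_fps Q'\<close> and with \<open>pCons 0 (pderiv (Q t))\<close> drop out.\<close>
  have P0': "fps_nth P' 0 = coeff C 0"
    using arg_cong[OF key, of "\<lambda>A. fps_nth A 0"] Q'_0[of 0] Q(2)[OF T(2)]
    by (simp add: coeff_pderiv)
  \<comment> \<open>This fixes the imaginary constant in \<open>C / P\<close>: the constant term of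
    \<open>P s\<close> is real at all times, hence so is its time derivative.\<close>
  have "Im (fps_nth P' 0) = 0"
  proof (rule vector_derivative_unique_within[OF T(3)])
    show "((\<lambda>s. Im (coeff (P s) 0)) has_vector_derivative Im (fps_nth P' 0)) ?F"
      by (rule bounded_linear.has_vector_derivative[OF bounded_linear_Im P'])
    show "((\<lambda>s. Im (coeff (P s) 0)) has_vector_derivative 0) ?F"
      by (rule has_vector_derivative_transform[OF T(2) P(2) has_vector_derivative_const])
  qed
  then have "Im (coeff C 0 / coeff (P t) 0) = 0"
    using P(2)[OF T(2)] by (simp add: P0' Im_divide)
  moreover have "Re (coeff C 0 / coeff (P t) 0) = \<mu>"
  proof -
    have "Re (poly C 0 / poly (P t) 0)
        = 1 / (2 * pi) * integral {0..2 * pi} (\<lambda>\<theta>. Re (poly C (cis \<theta>) / poly (P t) (cis \<theta>)))"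
      by (rule mean_of_real_part_on_circle) (use nz(1) in \<open>auto intro!: continuous_intros holomorphic_intros\<close>)
    also have "\<dots> = \<mu>"
      unfolding \<mu>_def by (simp only: C(3) norm_cis)
    finally show ?thesis
      by (simp add: poly_0_coeff_0)
  qed
  ultimately have C0: "coeff C 0 / coeff (P t) 0 = of_real \<mu>"
    by (simp add: complex_eq_iff)
  have deg: "degree (pderiv (pCons 0 C)) \<le> m" "degree (pCons 0 (pderiv (Q t))) \<le> n"
    using C(1) Q(1)[OF T(2)] by (auto simp: degree_pderiv degree_pCons_eq_if pderiv_eq_0_iff)
  \<comment> \<open>At index \<open>m + n\<close> of \<open>key\<close> the derivative of
    \<open>z * C\<close> contributes the factor \<open>m + 1\<close> and
    \<open>z * pderiv (Q t)\<close> the factor \<open>n\<close>; their difference is the origin of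
    \<open>m - n + 1\<close>.\<close>
  have "fps_nth P' m * coeff (Q t) n - Q' n * coeff (P t) m
      = coeff (Q t) n * (of_nat (m + 1) * coeff C m) - of_nat n * coeff (Q t) n * coeff C m"
  proof -
    have "fps_nth (P' * fps_of_poly (Q t)) (m + n) = fps_nth P' m * coeff (Q t) n"
      by (subst fps_mult_nth_degree_bounds) (use P'_0 Q(1)[OF T(2)] in \<open>auto simp: coeff_eq_0\<close>)
    moreover have "fps_nth (Abs_fps Q' * fps_of_poly (P t)) (n + m) = Q' n * coeff (P t) m"
      by (subst fps_mult_nth_degree_bounds) (use Q'_0 P(1)[OF T(2)] in \<open>auto simp: coeff_eq_0\<close>)
    moreover have "coeff (Q t * pderiv (pCons 0 C)) (n + m) = coeff (Q t) n * (of_nat (m + 1) * coeff C m)"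
      using coeff_mult_degree_bounds[OF _ deg(1), of "Q t" n] Q(1)[OF T(2)] by (simp add: coeff_pderiv)
    moreover have "coeff (pCons 0 (pderiv (Q t)) * C) (n + m) = of_nat n * coeff (Q t) n * coeff C m"
      using coeff_mult_degree_bounds[OF deg(2) C(1)] by (cases n) (simp_all add: coeff_pderiv)
    moreover have "fps_nth (P' * fps_of_poly (Q t)) (m + n) - fps_nth (Abs_fps Q' * fps_of_poly (P t)) (m + n)
        = coeff (Q t * pderiv (pCons 0 C)) (m + n) - coeff (pCons 0 (pderiv (Q t)) * C) (m + n)"
      using arg_cong[OF key, of "\<lambda>A. fps_nth A (m + n)"]
      by (simp only: fps_sub_nth fps_of_poly_nth flip: fps_of_poly_mult)
    ultimately show ?thesis
      by (simp only: add.commute[of n m])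
  qed
  also have "\<dots> = of_nat (m - n + 1) * coeff C m * coeff (Q t) n"
    using \<open>n \<le> m\<close> by (simp add: of_nat_diff algebra_simps)
  finally have "fps_nth P' m / coeff (P t) m - Q' n / coeff (Q t) n = of_nat (m - n + 1) * (coeff C m / coeff (P t) m)"
    using nz_coeffs by (simp add: diff_frac_eq nonzero_divide_eq_eq mult_ac)
  also have "coeff C m / coeff (P t) m
      = (if m = n then 2 * q * coeff (Q t) n / (coeff (P t) m * coeff (P t) 0) else 0) - of_real \<mu>"
  proof -
    have "cnj (coeff (P t) 0) = coeff (P t) 0"
      using P(2)[OF T(2)] by (simp add: complex_eq_iff)
    then show ?thesis
      unfolding C(4) C0 using Q(2)[OF T(2)] by simp
  qed
  finally show thesis
    using that[OF P' P' Q'] C0 P0' by simp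
qed

section \<open>Zeros and poles\<close>

text \<open>Normalised at 0 instead of monic: only reciprocals of the roots enter, which are bounded
  for roots outside the disk, and the top coefficient is the reciprocal of their product up to
  sign.\<close>

definition normalized_poly :: "nat \<Rightarrow> (nat \<Rightarrow> complex) \<Rightarrow> complex poly" where
  "normalized_poly N c = (\<Prod>k<N. [:1, - (1 / c k):])"

lemma poly_normalized_poly: "poly (normalized_poly N c) z = (\<Prod>k<N. 1 - z / c k)"
  by (simp add: normalized_poly_def poly_prod)

lemma coeff_0_normalized_poly: "coeff (normalized_poly N c) 0 = 1"
  by (simp add: poly_normalized_poly flip: poly_0_coeff_0)

lemma
  assumes "\<And>k. k < N \<Longrightarrow> c k \<noteq> 0"
  shows degree_normalized_poly: "degree (normalized_poly N c) = N"
    and coeff_degree_normalized_poly: "coeff (normalized_poly N c) N = (\<Prod>k<N. - (1 / c k))"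
    and prod_diff_eq_normalized_poly: "(\<Prod>k<N. z - c k) = (\<Prod>k<N. - c k) * poly (normalized_poly N c) z"
proof -
  show deg: "degree (normalized_poly N c) = N"
    unfolding normalized_poly_def using assms by (subst degree_prod_eq_sum_degree) auto
  have "lead_coeff (normalized_poly N c) = (\<Prod>k<N. - (1 / c k))"
    unfolding normalized_poly_def lead_coeff_prod using assms by (intro prod.cong) auto
  then show "coeff (normalized_poly N c) N = (\<Prod>k<N. - (1 / c k))"
    by (simp add: deg)
  show "(\<Prod>k<N. z - c k) = (\<Prod>k<N. - c k) * poly (normalized_poly N c) z"
    unfolding poly_normalized_poly prod.distrib[symmetric]
    by (rule prod.cong) (use assms in \<open>auto simp: field_simps\<close>)
qed

lemma poly_normalized_poly_eq_0D:
  assumes "poly (normalized_poly N c) z = 0"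
  shows "\<exists>k<N. c k = z"
proof -
  obtain k where "k < N" "1 - z / c k = 0"
    using assms by (auto simp: poly_normalized_poly)
  \<comment> \<open>If \<open>c k = 0\<close>, then \<open>z / c k = 0\<close> and the factor is 1,
    so this case cannot occur.\<close>
  then show ?thesis
    by (cases "c k = 0") auto
qed

text \<open>Each factor has \<open>|1 / c k| \<le> 1\<close> and at most doubles a bound on the
  coefficients. The bound is independent of the roots, hence uniform in time even for poles that run
  off to infinity.\<close>

lemma norm_coeff_normalized_poly_le:
  assumes "\<And>k. k < N \<Longrightarrow> norm (c k) \<ge> 1"
  shows "norm (coeff (normalized_poly N c) i) \<le> 2 ^ N"
  using assms
proof (induction N arbitrary: i)
  case 0
  then show ?case
    by (simp add: normalized_poly_def)
next
  case (Suc N)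
  define p where "p = normalized_poly N c"
  have p: "norm (coeff p j) \<le> 2 ^ N" for j
    unfolding p_def by (rule Suc.IH) (use Suc.prems in auto)
  have "norm (1 / c N) \<le> 1"
    using Suc.prems[of N] by (simp add: norm_divide divide_le_eq_1)
  then have *: "norm (1 / c N * coeff p j) \<le> 2 ^ N" for j
    using mult_mono[OF _ p[of j], of "norm (1 / c N)" 1] by (simp only: norm_mult) simp
  have "normalized_poly (Suc N) c = p - smult (1 / c N) (pCons 0 p)"
    by (simp add: normalized_poly_def p_def lessThan_Suc mult.commute)
  then have "coeff (normalized_poly (Suc N) c) i = coeff p i - (case i of 0 \<Rightarrow> 0 | Suc j \<Rightarrow> 1 / c N * coeff p j)"
    by (simp add: coeff_pCons split: nat.split)
  also have "norm \<dots> \<le> norm (coeff p i) + norm (case i of 0 \<Rightarrow> 0 | Suc j \<Rightarrow> 1 / c N * coeff p j)"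
    by (rule norm_triangle_ineq4)
  also have "\<dots> \<le> 2 ^ N + 2 ^ N"
    using p[of i] * by (intro add_mono) (auto split: nat.split)
  finally show ?case
    by simp
qed

lemma mu_mass_pos:
  assumes "q > 0" and cont: "continuous_on (sphere 0 1) (\<lambda>z. space_deriv f z t)"
    and nz: "\<And>z. norm z = 1 \<Longrightarrow> space_deriv f z t \<noteq> 0"
  shows "mu_mass q f t > 0"
proof -
  let ?h = "\<lambda>\<theta>. q / (norm (space_deriv f (cis \<theta>) t))\<^sup>2"
  have h: "continuous_on {0..2 * pi} ?h"
    by (intro continuous_intros continuous_on_compose2[OF cont]) (use nz in auto)
  have pos: "?h \<theta> > 0" for \<theta>
    using assms(1) nz[of "cis \<theta>"] by simp
  have "integral {0..2 * pi} (\<lambda>_. 0) < integral {0..2 * pi} ?h"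
    by (rule integral_less_real[OF continuous_on_const h _ pos]) (simp add: not_le)
  then show ?thesis
    by (simp add: mu_mass_def)
qed

text \<open>The products of zeros and poles are \<open>(-1) ^ m * coeff P 0 / coeff P m\<close> and
  \<open>(-1) ^ n / coeff Q n\<close>, so their logarithmic derivatives come from those of three
  extreme coefficients.\<close>

lemma root_products_has_vector_derivative:
  fixes T :: "real set" and q :: "real \<Rightarrow> real" and f :: "complex \<Rightarrow> real \<Rightarrow> complex"
    and b :: "real \<Rightarrow> complex" and m n :: nat and \<omega> \<zeta> :: "nat \<Rightarrow> real \<Rightarrow> complex"
  assumes T: "convex T" "t \<in> T" "at t within T \<noteq> bot"
    and sol: "locally_univalent_solution T q f" and "n \<le> m"
    and rat: "has_rational_derivative T f b m \<omega> n \<zeta>"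
  obtains W' Z' where
    "((\<lambda>s. \<Prod>k<m. \<omega> k s) has_vector_derivative W') (at t within T)"
    "((\<lambda>s. \<Prod>j<n. \<zeta> j s) has_vector_derivative Z') (at t within T)"
    "W' / (\<Prod>k<m. \<omega> k t) - Z' / (\<Prod>j<n. \<zeta> j t) =
      (if m = n
       then 2 * (of_real (mu_mass (q t) f t) -
                 A_infinity (q t) (rational_fun (b t) m (\<lambda>k. \<omega> k t) n (\<lambda>j. \<zeta> j t)))
       else of_real ((real m - real n + 2) * mu_mass (q t) f t))"
proof -
  let ?F = "at t within T"
  define g where "g s = rational_fun (b s) m (\<lambda>k. \<omega> k s) n (\<lambda>j. \<zeta> j s)" for s
  define Q where "Q s = normalized_poly n (\<lambda>j. \<zeta> j s)" for s
  \<comment> \<open>The factor \<open>g s 0\<close> is the value of \<open>f'\<close> at 0. It makes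
    \<open>P s / Q s\<close> equal to \<open>f'\<close> on the disk and the constant term of
    \<open>P s\<close> real.\<close>
  define P where "P s = smult (g s 0) (normalized_poly m (\<lambda>k. \<omega> k s))" for s
  have b: "b s \<noteq> 0" and \<omega>: "k < m \<Longrightarrow> norm (\<omega> k s) > 1" and \<zeta>: "j < n \<Longrightarrow> norm (\<zeta> j s) > 1"
    and disjoint: "k < m \<Longrightarrow> j < n \<Longrightarrow> \<omega> k s \<noteq> \<zeta> j s"
    and deriv_f: "norm z \<le> 1 \<Longrightarrow> space_deriv f z s = g s z" if "s \<in> T" for s j k z
    using rat that unfolding has_rational_derivative_def g_def by auto
  have \<omega>0: "k < m \<Longrightarrow> \<omega> k s \<noteq> 0" and \<zeta>0: "j < n \<Longrightarrow> \<zeta> j s \<noteq> 0" if "s \<in> T" for s j k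
    using \<omega>[OF that, of k] \<zeta>[OF that, of j] by auto
  have an: "(\<lambda>z. f z s) analytic_on cball 0 1" and f0: "f 0 s = 0"
    and real: "Im (space_deriv f 0 s) = 0"
    and PG: "norm z = 1 \<Longrightarrow> Re (time_deriv T (f z) s * cnj (z * space_deriv f z s)) = q s"
    if "s \<in> T" for s z
    using sol that unfolding locally_univalent_solution_def by (auto simp: complex_is_Real_iff)
  have der: "(f z has_vector_derivative time_deriv T (f z) s) (at s within T)"
    if "z \<in> cball 0 1" "s \<in> T" for z s
    using sol that unfolding locally_univalent_solution_def smooth_in_time_def time_deriv_def
      differentiable_on_def by (auto simp flip: vector_derivative_works)
  have u: "continuous_on (cball 0 1 \<times> T) (\<lambda>(z, s). time_deriv T (f z) s)"
    using sol unfolding locally_univalent_solution_def smooth_in_time_def by blast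
  have g0: "g s 0 = b s * (\<Prod>k<m. - \<omega> k s) / (\<Prod>j<n. - \<zeta> j s)" for s
    by (simp add: g_def rational_fun_def)
  have g0_nz: "g s 0 \<noteq> 0" if "s \<in> T" for s
    using b[OF that] \<omega>0[OF that] \<zeta>0[OF that] by (auto simp: g0)
  have g_PQ: "g s z = poly (P s) z / poly (Q s) z" if "s \<in> T" for s z
    using prod_diff_eq_normalized_poly[of m "\<lambda>k. \<omega> k s" z] prod_diff_eq_normalized_poly[of n "\<lambda>j. \<zeta> j s" z]
      \<omega>0[OF that] \<zeta>0[OF that]
    by (simp add: P_def Q_def g0) (simp add: g_def rational_fun_def)
  have degP: "degree (P s) = m" and degQ: "degree (Q s) = n" if "s \<in> T" for s
    using degree_normalized_poly[of m "\<lambda>k. \<omega> k s"] degree_normalized_poly[of n "\<lambda>j. \<zeta> j s"]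
      \<omega>0[OF that] \<zeta>0[OF that] g0_nz[OF that] by (auto simp: P_def Q_def)
  have P_0: "coeff (P s) 0 = g s 0" and Q_0: "coeff (Q s) 0 = 1" for s
    by (simp_all add: P_def Q_def coeff_0_normalized_poly)
  have P_m: "coeff (P s) m = g s 0 * (\<Prod>k<m. - (1 / \<omega> k s))"
    and Q_n: "coeff (Q s) n = (\<Prod>j<n. - (1 / \<zeta> j s))" if "s \<in> T" for s
    using coeff_degree_normalized_poly[of m "\<lambda>k. \<omega> k s"] coeff_degree_normalized_poly[of n "\<lambda>j. \<zeta> j s"]
      \<omega>0[OF that] \<zeta>0[OF that] by (auto simp: P_def Q_def)
  have P_root: "\<exists>k<m. \<omega> k s = z" if "s \<in> T" "poly (P s) z = 0" for s z
    using that g0_nz poly_normalized_poly_eq_0D by (auto simp: P_def)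
  have Q_root: "\<exists>j<n. \<zeta> j s = z" if "poly (Q s) z = 0" for s z
    using that poly_normalized_poly_eq_0D by (auto simp: Q_def)
  have P_nz: "poly (P s) z \<noteq> 0" and Q_nz: "poly (Q s) z \<noteq> 0" if "s \<in> T" "norm z \<le> 1" for s z
    using P_root[of s z] Q_root[of s z] \<omega>[OF that(1)] \<zeta>[OF that(1)] that by force+
  have cop: "coprime (P t) (Q t)"
    by (rule coprime_complex_polyI) (use P_root[OF T(2)] Q_root disjoint[OF T(2)] in blast)
  have Q_bound: "norm (coeff (Q s) i) \<le> 2 ^ n" if "s \<in> T" for s i
    unfolding Q_def by (rule norm_coeff_normalized_poly_le) (use \<zeta>[OF that] in force)
  have \<mu>: "mu_mass (q t) f t = 1 / (2 * pi) * integral {0..2 * pi}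
      (\<lambda>\<theta>. q t / (norm (poly (P t) (cis \<theta>) / poly (Q t) (cis \<theta>)))\<^sup>2)"
    unfolding mu_mass_def by (simp add: deriv_f[OF T(2)] g_PQ[OF T(2)])
  obtain P0' Pm' Qn' where P0': "((\<lambda>s. coeff (P s) 0) has_vector_derivative P0') ?F"
    and Pm': "((\<lambda>s. coeff (P s) m) has_vector_derivative Pm') ?F"
    and Qn': "((\<lambda>s. coeff (Q s) n) has_vector_derivative Qn') ?F"
    and P0'_eq: "P0' / coeff (P t) 0 = of_real (mu_mass (q t) f t)"
    and Pm'_eq: "Pm' / coeff (P t) m - Qn' / coeff (Q t) n = of_nat (m - n + 1) *
       ((if m = n then 2 * q t * coeff (Q t) n / (coeff (P t) m * coeff (P t) 0) else 0)
        - of_real (mu_mass (q t) f t))"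
  proof (rule rational_solution_coeff_derivatives[where u = "\<lambda>z. time_deriv T (f z)" and P = P and Q = Q
        and q = "q t" and K = "2 ^ n", OF T der u an f0 \<open>n \<le> m\<close> degP _ degQ Q_0 Q_bound P_nz[OF T(2)] Q_nz cop, folded \<mu>])
    show "Im (coeff (P s) 0) = 0" if "s \<in> T" for s
      using real[OF that] deriv_f[OF that, of 0] by (simp add: P_0)
    show "deriv (\<lambda>z. f z s) z = poly (P s) z / poly (Q s) z" if "s \<in> T" "z \<in> ball 0 1" for s z
      using deriv_f[OF that(1), of z] g_PQ[OF that(1)] that(2) by (simp add: space_deriv_def)
    show "Re (time_deriv T (f z) t * cnj (z * (poly (P t) z / poly (Q t) z))) = q t" if "norm z = 1" for z
      using PG[OF T(2) that] deriv_f[OF T(2), of z] that by (simp add: g_PQ[OF T(2)])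
  qed (assumption | rule that)+
  define W where "W s = (\<Prod>k<m. \<omega> k s)" for s
  define Z where "Z s = (\<Prod>j<n. \<zeta> j s)" for s
  have W_nz: "W s \<noteq> 0" and Z_nz: "Z s \<noteq> 0" if "s \<in> T" for s
    using \<omega>0[OF that] \<zeta>0[OF that] by (auto simp: W_def Z_def)
  have prod_inv: "(\<Prod>k<N. - (1 / c k)) = (-1) ^ N / (\<Prod>k<N. c k)" for N and c :: "nat \<Rightarrow> complex"
    by (induction N) auto
  have P_m: "coeff (P s) m = coeff (P s) 0 * ((-1) ^ m / W s)" if "s \<in> T" for s
    using P_m[OF that] by (simp add: P_0 prod_inv W_def)
  have Q_n: "coeff (Q s) n = (-1) ^ n / Z s" if "s \<in> T" for s
    using Q_n[OF that] by (simp add: prod_inv Z_def)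
  have coeff_nz: "coeff (P t) 0 \<noteq> 0" "coeff (P t) m \<noteq> 0" "coeff (Q t) n \<noteq> 0"
    using g0_nz W_nz Z_nz T(2) P_m Q_n by (auto simp: P_0)
  have W_eq: "W s = (-1) ^ m * (coeff (P s) 0 / coeff (P s) m)" if "s \<in> T" for s
    using W_nz[OF that] g0_nz[OF that] by (simp add: P_m[OF that] P_0)
  have Z_eq: "Z s = (-1) ^ n / coeff (Q s) n" if "s \<in> T" for s
    using Z_nz[OF that] by (simp add: Q_n[OF that])
  have W': "(W has_vector_derivative W t * (P0' / coeff (P t) 0 - Pm' / coeff (P t) m)) ?F"
  proof (rule has_vector_derivative_transform[OF T(2) W_eq])
    have "((\<lambda>s. (-1) ^ m * (coeff (P s) 0 / coeff (P s) m)) has_vector_derivative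
        (-1) ^ m * ((P0' - coeff (P t) 0 / coeff (P t) m * Pm') / coeff (P t) m)) ?F"
      by (intro has_vector_derivative_mult_right has_vector_derivative_divide P0' Pm' coeff_nz)
    moreover have "(-1) ^ m * ((P0' - coeff (P t) 0 / coeff (P t) m * Pm') / coeff (P t) m)
        = W t * (P0' / coeff (P t) 0 - Pm' / coeff (P t) m)"
      using coeff_nz by (simp add: W_eq[OF T(2)] right_diff_distrib diff_divide_distrib)
    ultimately show "((\<lambda>s. (-1) ^ m * (coeff (P s) 0 / coeff (P s) m)) has_vector_derivative
        W t * (P0' / coeff (P t) 0 - Pm' / coeff (P t) m)) ?F"
      by simp
  qed
  have Z': "(Z has_vector_derivative Z t * - (Qn' / coeff (Q t) n)) ?F"
  proof (rule has_vector_derivative_transform[OF T(2) Z_eq])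
    have "((\<lambda>s. (-1) ^ n / coeff (Q s) n) has_vector_derivative
        (0 - (-1) ^ n / coeff (Q t) n * Qn') / coeff (Q t) n) ?F"
      by (intro has_vector_derivative_divide has_vector_derivative_const Qn' coeff_nz)
    then show "((\<lambda>s. (-1) ^ n / coeff (Q s) n) has_vector_derivative Z t * - (Qn' / coeff (Q t) n)) ?F"
      by (simp add: Z_eq[OF T(2)])
  qed
  show thesis
  proof (rule that[OF W'[unfolded W_def] Z'[unfolded Z_def], folded W_def Z_def])
    let ?\<mu> = "complex_of_real (mu_mass (q t) f t)"
    have "W t * (P0' / coeff (P t) 0 - Pm' / coeff (P t) m) / W t - Z t * - (Qn' / coeff (Q t) n) / Z t
        = P0' / coeff (P t) 0 - (Pm' / coeff (P t) m - Qn' / coeff (Q t) n)"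
      using W_nz[OF T(2)] Z_nz[OF T(2)] by simp
    \<comment> \<open>The value is \<open>?\<mu> - (2 * A - ?\<mu>)\<close> for
      \<open>m = n\<close>, with \<open>A\<close> the limit at infinity, and
      \<open>?\<mu> + (m - n + 1) * ?\<mu>\<close> for \<open>m > n\<close>.\<close>
    also have "\<dots> = (if m = n then 2 * (?\<mu> - A_infinity (q t) (g t))
        else of_real ((real m - real n + 2) * mu_mass (q t) f t))"
    proof (cases "m = n")
      case True
      have "cnj (g t 0) = g t 0"
        using real[OF T(2)] deriv_f[OF T(2), of 0] by (simp add: complex_eq_iff)
      moreover have "g t = rational_fun (b t) n (\<lambda>k. \<omega> k t) n (\<lambda>j. \<zeta> j t)"
        by (simp add: g_def True)
      ultimately have "A_infinity (q t) (g t) = q t / (b t * g t 0)"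
        using A_infinity_limit(2)[of "b t" n "\<lambda>k. \<omega> k t" "\<lambda>j. \<zeta> j t" "q t"]
          b[OF T(2)] \<omega>0[OF T(2)] \<zeta>0[OF T(2)] True by simp
      \<comment> \<open>With equally many zeros and poles the signs cancel; \<open>b t\<close> is
        then the quotient of the top coefficients, which identifies the coefficient expression with
        \<open>A_infinity\<close>.\<close>
      moreover have "g t 0 = b t * (W t / Z t)"
        by (simp add: g0 prod_uminus W_def Z_def True)
      then have "coeff (P t) m = b t * coeff (Q t) n"
        unfolding P_m[OF T(2)] Q_n[OF T(2)] P_0 using True W_nz[OF T(2)] by simp
      ultimately have "2 * q t * coeff (Q t) n / (coeff (P t) m * coeff (P t) 0) = 2 * A_infinity (q t) (g t)"
        using coeff_nz by (simp add: P_0)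
      then show ?thesis
        using True unfolding P0'_eq Pm'_eq by simp
    next
      case False
      then show ?thesis
        using \<open>n \<le> m\<close> unfolding P0'_eq Pm'_eq by (simp add: of_nat_diff algebra_simps)
    qed
    finally show "W t * (P0' / coeff (P t) 0 - Pm' / coeff (P t) m) / W t - Z t * - (Qn' / coeff (Q t) n) / Z t
        = (if m = n then 2 * (?\<mu> - A_infinity (q t) (rational_fun (b t) m (\<lambda>k. \<omega> k t) n (\<lambda>j. \<zeta> j t)))
           else of_real ((real m - real n + 2) * mu_mass (q t) f t))"
      by (simp only: g_def)
  qed
qed

text \<open>A connected set with more than one point has no isolated point. This makes derivatives
  within \<open>T\<close> unique, also at end points.\<close>

lemma time_interval_at_within_neq_bot:
  assumes "time_interval T" "t \<in> T"
  shows "at t within T \<noteq> bot"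
proof -
  have "connected T" "\<And>x. T \<noteq> {x}"
    using assms by (auto simp: time_interval_def is_interval_connected_1)
  then show ?thesis
    using connected_imp_perfect[OF _ assms(2)] by (simp add: trivial_limit_within)
qed

theorem proposition3p2:
  fixes T :: "real set" and q :: "real \<Rightarrow> real" and f :: "complex \<Rightarrow> real \<Rightarrow> complex"
    and b :: "real \<Rightarrow> complex" and m n :: nat and \<omega> \<zeta> :: "nat \<Rightarrow> real \<Rightarrow> complex"
  assumes "time_interval T"
    and "continuous_on T q" and "\<And>t. t \<in> T \<Longrightarrow> q t > 0"
    and "locally_univalent_solution T q f"
    and "m \<ge> n"
    and "has_rational_derivative T f b m \<omega> n \<zeta>"
  shows "(\<forall>L M. continuous_log_sum T m \<omega> L \<longrightarrow> continuous_log_sum T n \<zeta> M \<longrightarrow>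
            L differentiable_on T \<and> M differentiable_on T \<and>
            (\<forall>t\<in>T. time_deriv T L t - time_deriv T M t =
               (if m = n
                then 2 * (of_real (mu_mass (q t) f t) -
                          A_infinity (q t) (rational_fun (b t) m (\<lambda>k. \<omega> k t) n (\<lambda>j. \<zeta> j t)))
                else of_real ((real m - real n + 2) * mu_mass (q t) f t))))
       \<and> (m > n \<longrightarrow>
            (\<lambda>t. \<Sum>k<m. ln (norm (\<omega> k t))) differentiable_on T \<and>
            (\<lambda>t. \<Sum>j<n. ln (norm (\<zeta> j t))) differentiable_on T \<and>
            (\<forall>t\<in>T. time_deriv T (\<lambda>t. \<Sum>k<m. ln (norm (\<omega> k t))) t
                   > time_deriv T (\<lambda>t. \<Sum>j<n. ln (norm (\<zeta> j t))) t) \<and>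
            (\<forall>\<Theta> \<Phi>. continuous_arg_sum T m \<omega> \<Theta> \<longrightarrow> continuous_arg_sum T n \<zeta> \<Phi> \<longrightarrow>
               \<Theta> differentiable_on T \<and> \<Phi> differentiable_on T \<and>
               (\<forall>t\<in>T. time_deriv T \<Theta> t = time_deriv T \<Phi> t)))"
proof -
  have conv: "convex T" and nontriv: "\<And>t. t \<in> T \<Longrightarrow> at t within T \<noteq> bot"
    using assms(1) time_interval_at_within_neq_bot by (auto simp: time_interval_def is_interval_convex_1)
  define W where "W t = (\<Prod>k<m. \<omega> k t)" for t
  define Z where "Z t = (\<Prod>j<n. \<zeta> j t)" for t
  define rhs where "rhs t = (if m = n
      then 2 * (of_real (mu_mass (q t) f t) -
                A_infinity (q t) (rational_fun (b t) m (\<lambda>k. \<omega> k t) n (\<lambda>j. \<zeta> j t)))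
      else of_real ((real m - real n + 2) * mu_mass (q t) f t))" for t
  have "\<exists>W' Z'. (W has_vector_derivative W') (at t within T) \<and> (Z has_vector_derivative Z') (at t within T)
      \<and> W' / W t - Z' / Z t = rhs t" if "t \<in> T" for t
    using root_products_has_vector_derivative[OF conv that nontriv[OF that] assms(4,5,6)]
    unfolding W_def Z_def rhs_def by metis
  then obtain W' Z' where W': "\<And>t. t \<in> T \<Longrightarrow> (W has_vector_derivative W' t) (at t within T)"
    and Z': "\<And>t. t \<in> T \<Longrightarrow> (Z has_vector_derivative Z' t) (at t within T)"
    and quot: "\<And>t. t \<in> T \<Longrightarrow> W' t / W t - Z' t / Z t = rhs t"
    by metis
  have norms: "norm (\<omega> k t) > 1 \<or> k \<ge> m" "norm (\<zeta> j t) > 1 \<or> j \<ge> n" if "t \<in> T" for t k j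
    using assms(6) that by (auto simp: has_rational_derivative_def not_le)
  have nz: "W t \<noteq> 0" "Z t \<noteq> 0" if "t \<in> T" for t
  proof -
    have "k < m \<Longrightarrow> \<omega> k t \<noteq> 0" "j < n \<Longrightarrow> \<zeta> j t \<noteq> 0" for k j
      using norms(1)[OF that, of k] norms(2)[OF that, of j] by auto
    then show "W t \<noteq> 0" "Z t \<noteq> 0"
      by (auto simp: W_def Z_def)
  qed
  have deriv: "u differentiable_on T \<and> (\<forall>t\<in>T. time_deriv T u t = u' t)"
    if "\<And>t. t \<in> T \<Longrightarrow> (u has_vector_derivative u' t) (at t within T)"
    for u u' :: "real \<Rightarrow> 'a::real_normed_vector"
    using that nontriv
    by (auto simp: differentiable_on_def time_deriv_def differentiable_def has_vector_derivative_def
        vector_derivative_within)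
  have logs: "L differentiable_on T \<and> M differentiable_on T \<and> (\<forall>t\<in>T. time_deriv T L t - time_deriv T M t = rhs t)"
    if "continuous_log_sum T m \<omega> L" "continuous_log_sum T n \<zeta> M" for L M
  proof -
    have "(L has_vector_derivative W' t / W t) (at t within T)" if "t \<in> T" for t
      by (rule continuous_log_has_vector_derivative[OF that W'[OF that]])
        (use \<open>continuous_log_sum T m \<omega> L\<close> in \<open>auto simp: W_def exp_continuous_log_sum continuous_log_sum_def[of _ _ _ L]\<close>)
    moreover have "(M has_vector_derivative Z' t / Z t) (at t within T)" if "t \<in> T" for t
      by (rule continuous_log_has_vector_derivative[OF that Z'[OF that]])
        (use \<open>continuous_log_sum T n \<zeta> M\<close> in \<open>auto simp: Z_def exp_continuous_log_sum continuous_log_sum_def[of _ _ _ M]\<close>)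
    ultimately show ?thesis
      using deriv[of L "\<lambda>t. W' t / W t"] deriv[of M "\<lambda>t. Z' t / Z t"] quot by auto
  qed
  \<comment> \<open>For \<open>m > n\<close> the right-hand side is a positive real number: its real
    part gives the inequality for the moduli, its imaginary part the equality for the
    arguments.\<close>
  have rhs_pos: "Re (rhs t) > 0" "Im (rhs t) = 0" if t: "t \<in> T" "m > n" for t
  proof -
    have an: "(\<lambda>z. f z t) analytic_on cball 0 1" and "\<And>z. z \<in> cball 0 1 \<Longrightarrow> space_deriv f z t \<noteq> 0"
      using assms(4) t(1) by (auto simp: locally_univalent_solution_def)
    moreover have "continuous_on (sphere 0 1) (\<lambda>z. space_deriv f z t)"
      using analytic_deriv[OF an] unfolding space_deriv_def
      by (intro holomorphic_on_imp_continuous_on analytic_imp_holomorphic) (auto elim: analytic_on_subset)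
    ultimately have "mu_mass (q t) f t > 0"
      by (intro mu_mass_pos assms(3) t) auto
    then show "Re (rhs t) > 0" "Im (rhs t) = 0"
      using t(2) by (auto simp: rhs_def)
  qed
  have ln_norm: "((\<lambda>t. \<Sum>k<m. ln (norm (\<omega> k t))) has_vector_derivative Re (W' t / W t)) (at t within T)"
    "((\<lambda>t. \<Sum>j<n. ln (norm (\<zeta> j t))) has_vector_derivative Re (Z' t / Z t)) (at t within T)" if t: "t \<in> T" for t
  proof -
    \<comment> \<open>The sum depends on the product of the roots alone, so it is differentiable
      even where single terms are not.\<close>
    have ln_prod_norm: "(\<Sum>k<N. ln (norm (z k))) = ln (norm (\<Prod>k<N. z k))"
      if "\<And>k. norm (z k) > 1 \<or> k \<ge> N" for N and z :: "nat \<Rightarrow> complex"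
    proof -
      have "norm (z k) \<noteq> 0" if "k < N" for k
        using \<open>norm (z k) > 1 \<or> k \<ge> N\<close> that by auto
      then show ?thesis
        unfolding prod_norm[symmetric] by (intro ln_prod[symmetric]) auto
    qed
    show "((\<lambda>t. \<Sum>k<m. ln (norm (\<omega> k t))) has_vector_derivative Re (W' t / W t)) (at t within T)"
      by (rule has_vector_derivative_transform[OF t _ ln_norm_has_vector_derivative[OF t W'[OF t] nz(1)]])
        (simp_all add: W_def ln_prod_norm norms)
    show "((\<lambda>t. \<Sum>j<n. ln (norm (\<zeta> j t))) has_vector_derivative Re (Z' t / Z t)) (at t within T)"
      by (rule has_vector_derivative_transform[OF t _ ln_norm_has_vector_derivative[OF t Z'[OF t] nz(2)]])
        (simp_all add: Z_def ln_prod_norm norms)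
  qed
  have args: "\<Theta> differentiable_on T \<and> \<Phi> differentiable_on T \<and> (\<forall>t\<in>T. time_deriv T \<Theta> t = time_deriv T \<Phi> t)"
    if "continuous_arg_sum T m \<omega> \<Theta>" "continuous_arg_sum T n \<zeta> \<Phi>" "m > n" for \<Theta> \<Phi>
  proof -
    have "(\<Theta> has_vector_derivative Im (W' t / W t)) (at t within T)" if "t \<in> T" for t
      by (rule continuous_arg_has_vector_derivative[OF that W' nz(1)])
        (use \<open>continuous_arg_sum T m \<omega> \<Theta>\<close> cis_continuous_arg_sum[OF \<open>continuous_arg_sum T m \<omega> \<Theta>\<close>]
          in \<open>auto simp: W_def continuous_arg_sum_def[of _ _ _ \<Theta>]\<close>)
    moreover have "(\<Phi> has_vector_derivative Im (Z' t / Z t)) (at t within T)" if "t \<in> T" for t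
      by (rule continuous_arg_has_vector_derivative[OF that Z' nz(2)])
        (use \<open>continuous_arg_sum T n \<zeta> \<Phi>\<close> cis_continuous_arg_sum[OF \<open>continuous_arg_sum T n \<zeta> \<Phi>\<close>]
          in \<open>auto simp: Z_def continuous_arg_sum_def[of _ _ _ \<Phi>]\<close>)
    moreover have "Im (W' t / W t) = Im (Z' t / Z t)" if "t \<in> T" for t
      using rhs_pos(2)[OF that \<open>m > n\<close>] by (simp add: quot[OF that, symmetric])
    ultimately show ?thesis
      using deriv[of \<Theta> "\<lambda>t. Im (W' t / W t)"] deriv[of \<Phi> "\<lambda>t. Im (Z' t / Z t)"] by auto
  qed
  have "Re (W' t / W t) > Re (Z' t / Z t)" if "t \<in> T" "m > n" for t
    using rhs_pos(1)[OF that] by (simp add: quot[OF that(1), symmetric])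
  then show ?thesis
    using logs args deriv[OF ln_norm(1)] deriv[OF ln_norm(2)] unfolding rhs_def by auto
qed

end
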